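(* Let $(M,\varphi,\xi,\eta,g)$ be an almost contact B-metric manifold. The torsion $\dot{T}$ of the $\varphi$B-connection on $(M,\varphi,\xi,\eta,g)$ belongs to $\mathcal{T}_{3}\oplus\mathcal{T}_{4}\oplus\cdots\oplus\mathcal{T}_{15}$ (at every point of $M$).
   Context: An almost contact B-metric manifold $(M,\varphi,\xi,\eta,g)$ is a $(2n+1)$-dimensional smooth manifold with an endomorphism $\varphi$ of the tangent bundle, a vector field $\xi$, a 1-form $\eta$ and a pseudo-Riemannian metric $g$ of signature $(n,n+1)$ (so $g(\xi,\xi)=1$ and $g|_{\ker\eta}$ has signature $(n,n)$) such that $\varphi\xi=0$, $\varphi^2=-\mathrm{Id}+\eta\otimes\xi$, $\eta\circ\varphi=0$, $\eta(\xi)=1$, $g(\varphi X,\varphi Y)=-g(X,Y)+\eta(X)\eta(Y)$. $\nabla$ is the Levi-Civita connection of $g$. The $\varphi$B-connection is the linear connection $\dot{D}_xy=\nabla_xy+\frac12\{(\nabla_x\varphi)\varphi y+(\nabla_x\eta)y\cdot\xi\}-\eta(y)\nabla_x\xi$. Its torsion is $\dot T(x,y)=\dot D_xy-\dot D_yx-[x,y]$, and $\dot T(x,y,z)=g(\dot T(x,y),z)$. At each point put $V=T_pM$. $\mathcal{T}$ is the space of $(0,3)$-tensors $T$ on $V$ with $T(x,y,z)=-T(y,x,z)$, with inner product $\langle T_1,T_2\rangle=g^{iq}g^{jr}g^{ks}T_1(e_i,e_j,e_k)T_2(e_q,e_r,e_s)$. Notation: $\mathop{\mathfrak{S}}_{x,y,z}$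 is the cyclic sum; $\{A(x,y,z)\}_{[x\leftrightarrow y]}=A(x,y,z)-A(y,x,z)$; $t(x)=g^{ij}T(x,e_i,e_j)$, $t^*(x)=g^{ij}T(x,e_i,\varphi e_j)$, $\hat t(x)=T(x,\xi,\xi)$, where $\{e_i\}_{i=1}^{2n}$ is a basis of $\ker\eta$ and $(g^{ij})$ the inverse of $(g(e_i,e_j))$. Subspaces of $\mathcal{T}$ (conditions for all $x,y,z\in V$): $\mathcal{W}_{1,1}$: $T(\xi,y,z)=T(x,y,\xi)=0$, $T(x,y,z)=-T(\varphi x,\varphi y,z)=-T(x,\varphi y,\varphi z)$; $\mathcal{W}_{1,2}$: $T(\xi,y,z)=T(x,y,\xi)=0$, $T(x,y,z)=-T(\varphi x,\varphi y,z)=T(\varphi x,y,\varphi z)$; $\mathcal{W}_{1,3}$: $T(\xi,y,z)=T(x,y,\xi)=0$, $T(x,y,z)-T(\varphi x,\varphi y,z)=\mathop{\mathfrak{S}}_{x,y,z}T(x,y,z)=0$; $\mathcal{W}_{1,4}$: $T(\xi,y,z)=T(x,y,\xi)=0$, $T(x,y,z)-T(\varphi x,\varphi y,z)=\mathop{\mathfrak{S}}_{x,y,z}T(\varphi x,y,z)=0$; $\mathcal{W}_{2,1}$ (resp. $\mathcal{W}_{2,2}$): $T(x,y,z)=\eta(z)T(\varphi^2x,\varphi^2y,\xi)$ and $T(x,y,\xi)=-T(\varphi x,\varphi y,\xi)$ (resp. $T(x,y,\xi)=T(\varphi x,\varphi y,\xi)$); $\mathcal{W}_{3,k}$ ($k=1,2,3,4$):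 $T(x,y,z)=\{\eta(x)T(\xi,\varphi^2y,\varphi^2z)\}_{[x\leftrightarrow y]}$ and, respectively, $k=1$: $T(\xi,y,z)=T(\xi,z,y)=-T(\xi,\varphi y,\varphi z)$; $k=2$: $T(\xi,y,z)=-T(\xi,z,y)=-T(\xi,\varphi y,\varphi z)$; $k=3$: $T(\xi,y,z)=T(\xi,z,y)=T(\xi,\varphi y,\varphi z)$; $k=4$: $T(\xi,y,z)=-T(\xi,z,y)=T(\xi,\varphi y,\varphi z)$; $\mathcal{W}_{4,1}$: $T(x,y,z)=\eta(z)\{\eta(y)\hat t(x)-\eta(x)\hat t(y)\}$. The orthogonal decomposition $\mathcal{T}=\mathcal{T}_1\oplus\cdots\oplus\mathcal{T}_{15}$ is given by: $\mathcal{T}_2=\{T\in\mathcal{W}_{1,1}: t=0\}$ and $\mathcal{T}_1$ its orthogonal complement in $\mathcal{W}_{1,1}$ (so $\mathcal{T}_1\oplus\mathcal{T}_2=\mathcal{W}_{1,1}$); $\mathcal{T}_3=\mathcal{W}_{1,2}$; $\mathcal{T}_5=\{T\in\mathcal{W}_{1,3}: t=0\}$ and $\mathcal{T}_4$ its orthogonal complement in $\mathcal{W}_{1,3}$; $\mathcal{T}_6=\mathcal{W}_{1,4}$; $\mathcal{T}_7=\mathcal{W}_{2,1}$; $\mathcal{T}_8=\mathcal{W}_{2,2}$; $\mathcal{T}_{11}=\{T\in\mathcal{W}_{3,1}: t=t^*=0\}$; $\mathcal{T}_9$ (resp. $\mathcal{T}_{10}$) the set of $T\in\mathcal{W}_{3,1}$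 orthogonal to $\mathcal{T}_{11}$ with $t^*=0$ (resp. $t=0$); $\mathcal{T}_{12}=\mathcal{W}_{3,2}$; $\mathcal{T}_{13}=\mathcal{W}_{3,3}$; $\mathcal{T}_{14}=\mathcal{W}_{3,4}$; $\mathcal{T}_{15}=\mathcal{W}_{4,1}$. *)

theory Defs
  imports "HOL-Analysis.Analysis"
begin

section \<open>Linear algebra of a tangent space\<close>

text \<open>Signature with \<open>r\<close> positive and \<open>s\<close> negative squares, by means of an orthonormal basis of
  the whole space; in particular \<open>g\<close> is then nondegenerate.\<close>

definition has_signature :: "('v::real_vector \<Rightarrow> 'v \<Rightarrow> real) \<Rightarrow> nat \<Rightarrow> nat \<Rightarrow> bool" where
  "has_signature g r s \<longleftrightarrow> (\<exists>P N. finite P \<and> finite N \<and> card P = r \<and> card N = s \<and> P \<inter> N = {} \<and>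
     independent (P \<union> N) \<and> span (P \<union> N) = UNIV \<and>
     (\<forall>b\<in>P. g b b = 1) \<and> (\<forall>b\<in>N. g b b = -1) \<and>
     (\<forall>b\<in>P \<union> N. \<forall>c\<in>P \<union> N. b \<noteq> c \<longrightarrow> g b c = 0))"

definition some_basis :: "'v::real_vector set \<Rightarrow> 'v set" where
  "some_basis W = (SOME B. independent B \<and> span B = W)"

text \<open>The inverse \<open>(g\<^sup>i\<^sup>j)\<close> of the Gram matrix \<open>(g(e\<^sub>i, e\<^sub>j))\<close> of a basis \<open>B\<close>, with rows and
  columns indexed by the basis vectors themselves.\<close>

definition inverse_gram :: "('v \<Rightarrow> 'v \<Rightarrow> real) \<Rightarrow> 'v set \<Rightarrow> 'v \<Rightarrow> 'v \<Rightarrow> real" where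
  "inverse_gram g B = (THE h.
     (\<forall>a\<in>B. \<forall>c\<in>B. (\<Sum>b\<in>B. h a b * g b c) = (if a = c then 1 else 0)) \<and>
     (\<forall>a b. a \<notin> B \<or> b \<notin> B \<longrightarrow> h a b = 0))"

text \<open>\<open>g\<^sup>i\<^sup>j S(e\<^sub>i, e\<^sub>j)\<close> over a basis of the subspace \<open>W\<close>.\<close>

definition metric_trace ::
  "('v::real_vector \<Rightarrow> 'v \<Rightarrow> real) \<Rightarrow> 'v set \<Rightarrow> ('v \<Rightarrow> 'v \<Rightarrow> real) \<Rightarrow> real" where
  "metric_trace g W S =
     (\<Sum>i\<in>some_basis W. \<Sum>j\<in>some_basis W. inverse_gram g (some_basis W) i j * S i j)"

type_synonym 'v tensor3 = "'v \<Rightarrow> 'v \<Rightarrow> 'v \<Rightarrow> real"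

definition torsion_tensors :: "'v::real_vector tensor3 set" where
  "torsion_tensors = {T. (\<forall>y z. linear (\<lambda>x. T x y z)) \<and> (\<forall>x z. linear (\<lambda>y. T x y z)) \<and>
     (\<forall>x y. linear (\<lambda>z. T x y z)) \<and> (\<forall>x y z. T x y z = - T y x z)}"

definition tensor_inner ::
  "('v::real_vector \<Rightarrow> 'v \<Rightarrow> real) \<Rightarrow> 'v tensor3 \<Rightarrow> 'v tensor3 \<Rightarrow> real" where
  "tensor_inner g T1 T2 = (let B = some_basis UNIV; h = inverse_gram g B in
     (\<Sum>i\<in>B. \<Sum>j\<in>B. \<Sum>k\<in>B. \<Sum>q\<in>B. \<Sum>r\<in>B. \<Sum>s\<in>B.
        h i q * h j r * h k s * T1 i j k * T2 q r s))"

definition orth_compl_in ::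
  "('v::real_vector \<Rightarrow> 'v \<Rightarrow> real) \<Rightarrow> 'v tensor3 set \<Rightarrow> 'v tensor3 set \<Rightarrow> 'v tensor3 set" where
  "orth_compl_in g W U = {T \<in> W. \<forall>S\<in>U. tensor_inner g T S = 0}"

definition cyclic_sum :: "'v tensor3 \<Rightarrow> 'v tensor3" where
  "cyclic_sum A x y z = A x y z + A y z x + A z x y"

definition subspace_sum :: "'i set \<Rightarrow> ('i \<Rightarrow> 'v tensor3 set) \<Rightarrow> 'v tensor3 set" where
  "subspace_sum I C = {\<lambda>x y z. \<Sum>k\<in>I. S k x y z | S. \<forall>k\<in>I. S k \<in> C k}"

text \<open>The structure induced on a tangent space. In "signature \<open>(n, n+1)\<close>" the negative squares are
  counted first, as is forced by \<open>g(\<xi>, \<xi>) = 1\<close> (a consequence of the axioms).\<close>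

locale almost_contact_B_metric_space =
  fixes n :: nat
    and \<phi> :: "'v::euclidean_space \<Rightarrow> 'v"
    and \<xi> :: 'v
    and \<eta> :: "'v \<Rightarrow> real"
    and g :: "'v \<Rightarrow> 'v \<Rightarrow> real"
  assumes dim: "DIM('v) = 2 * n + 1"
    and linear_phi: "linear \<phi>"
    and linear_eta: "linear \<eta>"
    and bilinear_g: "bilinear g"
    and sym_g: "g x y = g y x"
    and signature_g: "has_signature g (n + 1) n"
    and phi_xi: "\<phi> \<xi> = 0"
    and phi_phi: "\<phi> (\<phi> x) = - x + \<eta> x *\<^sub>R \<xi>"
    and eta_phi: "\<eta> (\<phi> x) = 0"
    and eta_xi: "\<eta> \<xi> = 1"
    and g_phi_phi: "g (\<phi> x) (\<phi> y) = - g x y + \<eta> x * \<eta> y"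
begin

definition t_form :: "'v tensor3 \<Rightarrow> 'v \<Rightarrow> real" where
  "t_form T x = metric_trace g {v. \<eta> v = 0} (\<lambda>a b. T x a b)"

definition t_star_form :: "'v tensor3 \<Rightarrow> 'v \<Rightarrow> real" where
  "t_star_form T x = metric_trace g {v. \<eta> v = 0} (\<lambda>a b. T x a (\<phi> b))"

definition t_hat_form :: "'v tensor3 \<Rightarrow> 'v \<Rightarrow> real" where
  "t_hat_form T x = T x \<xi> \<xi>"

definition W11 :: "'v tensor3 set" where
  "W11 = {T \<in> torsion_tensors. \<forall>x y z. T \<xi> y z = 0 \<and> T x y \<xi> = 0 \<and>
     T x y z = - T (\<phi> x) (\<phi> y) z \<and> T x y z = - T x (\<phi> y) (\<phi> z)}"

definition W12 :: "'v tensor3 set" where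
  "W12 = {T \<in> torsion_tensors. \<forall>x y z. T \<xi> y z = 0 \<and> T x y \<xi> = 0 \<and>
     T x y z = - T (\<phi> x) (\<phi> y) z \<and> T x y z = T (\<phi> x) y (\<phi> z)}"

definition W13 :: "'v tensor3 set" where
  "W13 = {T \<in> torsion_tensors. \<forall>x y z. T \<xi> y z = 0 \<and> T x y \<xi> = 0 \<and>
     T x y z - T (\<phi> x) (\<phi> y) z = 0 \<and> cyclic_sum T x y z = 0}"

definition W14 :: "'v tensor3 set" where
  "W14 = {T \<in> torsion_tensors. \<forall>x y z. T \<xi> y z = 0 \<and> T x y \<xi> = 0 \<and>
     T x y z - T (\<phi> x) (\<phi> y) z = 0 \<and> cyclic_sum (\<lambda>u v w. T (\<phi> u) v w) x y z = 0}"

definition W21 :: "'v tensor3 set" where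
  "W21 = {T \<in> torsion_tensors. \<forall>x y z.
     T x y z = \<eta> z * T (\<phi> (\<phi> x)) (\<phi> (\<phi> y)) \<xi> \<and> T x y \<xi> = - T (\<phi> x) (\<phi> y) \<xi>}"

definition W22 :: "'v tensor3 set" where
  "W22 = {T \<in> torsion_tensors. \<forall>x y z.
     T x y z = \<eta> z * T (\<phi> (\<phi> x)) (\<phi> (\<phi> y)) \<xi> \<and> T x y \<xi> = T (\<phi> x) (\<phi> y) \<xi>}"

definition W3 :: "'v tensor3 set" where
  "W3 = {T \<in> torsion_tensors. \<forall>x y z.
     T x y z = \<eta> x * T \<xi> (\<phi> (\<phi> y)) (\<phi> (\<phi> z)) - \<eta> y * T \<xi> (\<phi> (\<phi> x)) (\<phi> (\<phi> z))}"

definition W31 :: "'v tensor3 set" where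
  "W31 = {T \<in> W3. \<forall>y z. T \<xi> y z = T \<xi> z y \<and> T \<xi> y z = - T \<xi> (\<phi> y) (\<phi> z)}"

definition W32 :: "'v tensor3 set" where
  "W32 = {T \<in> W3. \<forall>y z. T \<xi> y z = - T \<xi> z y \<and> T \<xi> y z = - T \<xi> (\<phi> y) (\<phi> z)}"

definition W33 :: "'v tensor3 set" where
  "W33 = {T \<in> W3. \<forall>y z. T \<xi> y z = T \<xi> z y \<and> T \<xi> y z = T \<xi> (\<phi> y) (\<phi> z)}"

definition W34 :: "'v tensor3 set" where
  "W34 = {T \<in> W3. \<forall>y z. T \<xi> y z = - T \<xi> z y \<and> T \<xi> y z = T \<xi> (\<phi> y) (\<phi> z)}"

definition W41 :: "'v tensor3 set" where
  "W41 = {T \<in> torsion_tensors. \<forall>x y z.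
     T x y z = \<eta> z * (\<eta> y * t_hat_form T x - \<eta> x * t_hat_form T y)}"

definition T2 :: "'v tensor3 set" where
  "T2 = {T \<in> W11. \<forall>x. t_form T x = 0}"

definition T1 :: "'v tensor3 set" where
  "T1 = orth_compl_in g W11 T2"

definition T5 :: "'v tensor3 set" where
  "T5 = {T \<in> W13. \<forall>x. t_form T x = 0}"

definition T4 :: "'v tensor3 set" where
  "T4 = orth_compl_in g W13 T5"

definition T11 :: "'v tensor3 set" where
  "T11 = {T \<in> W31. \<forall>x. t_form T x = 0 \<and> t_star_form T x = 0}"

definition T9 :: "'v tensor3 set" where
  "T9 = {T \<in> orth_compl_in g W31 T11. \<forall>x. t_star_form T x = 0}"

definition T10 :: "'v tensor3 set" where
  "T10 = {T \<in> orth_compl_in g W31 T11. \<forall>x. t_form T x = 0}"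

definition torsion_class :: "nat \<Rightarrow> 'v tensor3 set" where
  "torsion_class k =
    (if k = 1 then T1 else if k = 2 then T2 else if k = 3 then W12
     else if k = 4 then T4 else if k = 5 then T5 else if k = 6 then W14
     else if k = 7 then W21 else if k = 8 then W22
     else if k = 9 then T9 else if k = 10 then T10 else if k = 11 then T11
     else if k = 12 then W32 else if k = 13 then W33 else if k = 14 then W34
     else if k = 15 then W41 else {})"

end


section \<open>Smooth manifolds\<close>

primrec Ck_on ::
  "nat \<Rightarrow> 'a::real_normed_vector set \<Rightarrow> ('a \<Rightarrow> 'b::real_normed_vector) \<Rightarrow> bool" where
  "Ck_on 0 S f \<longleftrightarrow> continuous_on S f"
| "Ck_on (Suc k) S f \<longleftrightarrow> (\<forall>x\<in>S. f differentiable (at x)) \<and>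
     (\<forall>v. Ck_on k S (\<lambda>x. frechet_derivative f (at x) v))"

text \<open>Only used for open \<open>S\<close>.\<close>

definition smooth_on ::
  "'a::real_normed_vector set \<Rightarrow> ('a \<Rightarrow> 'b::real_normed_vector) \<Rightarrow> bool" where
  "smooth_on S f \<longleftrightarrow> (\<forall>k. Ck_on k S f)"

type_synonym ('m, 'e) chart = "'m set \<times> ('m \<Rightarrow> 'e)"

definition chart_inv :: "('m, 'e) chart \<Rightarrow> 'e \<Rightarrow> 'm" where
  "chart_inv c = inv_into (fst c) (snd c)"

definition is_chart :: "('m::topological_space, 'e::euclidean_space) chart \<Rightarrow> bool" where
  "is_chart c \<longleftrightarrow> open (fst c) \<and> open (snd c ` fst c) \<and>
     homeomorphism (fst c) (snd c ` fst c) (snd c) (chart_inv c)"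

text \<open>The manifold is the whole type \<open>'m\<close>; the atlas \<open>A\<close> need not be maximal.\<close>

locale smooth_manifold =
  fixes A :: "('m::{t2_space,second_countable_topology}, 'e::euclidean_space) chart set"
  assumes charts: "c \<in> A \<Longrightarrow> is_chart c"
    and covering: "(\<Union>c\<in>A. fst c) = UNIV"
    and compatible: "c \<in> A \<Longrightarrow> d \<in> A \<Longrightarrow>
      smooth_on (snd c ` (fst c \<inter> fst d)) (snd d \<circ> chart_inv c)"

text \<open>Fix for each point \<open>p\<close> a chart of \<open>A\<close> around it. A tangent vector at \<open>p\<close> is given by its
  components with respect to this chart, so that the tangent space at every point is a copy of \<open>'e\<close>,
  and a vector field is a function \<open>'m \<Rightarrow> 'e\<close>. The components with respect to another chart follow
  by the usual transformation law.\<close>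

definition chart_at :: "('m, 'e) chart set \<Rightarrow> 'm \<Rightarrow> ('m, 'e) chart" where
  "chart_at A p = (SOME c. c \<in> A \<and> p \<in> fst c)"

definition components ::
  "('m, 'e::euclidean_space) chart set \<Rightarrow> ('m, 'e) chart \<Rightarrow> 'm \<Rightarrow> 'e \<Rightarrow> 'e" where
  "components A c p v =
     frechet_derivative (snd c \<circ> chart_inv (chart_at A p)) (at (snd (chart_at A p) p)) v"

definition field_rep ::
  "('m, 'e::euclidean_space) chart set \<Rightarrow> ('m, 'e) chart \<Rightarrow> ('m \<Rightarrow> 'e) \<Rightarrow> 'e \<Rightarrow> 'e" where
  "field_rep A c X y = components A c (chart_inv c y) (X (chart_inv c y))"

text \<open>Functions and vector fields are total, but those defined on an open set \<open>U\<close> only are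
  covered by the following two notions, which disregard the values outside \<open>U\<close>.\<close>

definition smooth_fun_on ::
  "('m, 'e::euclidean_space) chart set \<Rightarrow> 'm set \<Rightarrow> ('m \<Rightarrow> real) \<Rightarrow> bool" where
  "smooth_fun_on A U f \<longleftrightarrow> (\<forall>c\<in>A. smooth_on (snd c ` (fst c \<inter> U)) (f \<circ> chart_inv c))"

definition smooth_field_on ::
  "('m, 'e::euclidean_space) chart set \<Rightarrow> 'm set \<Rightarrow> ('m \<Rightarrow> 'e) \<Rightarrow> bool" where
  "smooth_field_on A U X \<longleftrightarrow> (\<forall>c\<in>A. smooth_on (snd c ` (fst c \<inter> U)) (field_rep A c X))"

text \<open>The derivative of the function \<open>f\<close> in the direction of the tangent vector \<open>v\<close> at \<open>p\<close>.\<close>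

definition dir_deriv ::
  "('m, 'e::euclidean_space) chart set \<Rightarrow> 'm \<Rightarrow> 'e \<Rightarrow> ('m \<Rightarrow> real) \<Rightarrow> real" where
  "dir_deriv A p v f =
     frechet_derivative (f \<circ> chart_inv (chart_at A p)) (at (snd (chart_at A p) p)) v"

text \<open>The Lie bracket \<open>[X, Y]\<^sub>p\<close>, in the coordinates of the chart at \<open>p\<close>.\<close>

definition lie_bracket ::
  "('m, 'e::euclidean_space) chart set \<Rightarrow> 'm \<Rightarrow> ('m \<Rightarrow> 'e) \<Rightarrow> ('m \<Rightarrow> 'e) \<Rightarrow> 'e" where
  "lie_bracket A p X Y = (let c = chart_at A p in
     frechet_derivative (field_rep A c Y) (at (snd c p)) (X p) -
     frechet_derivative (field_rep A c X) (at (snd c p)) (Y p))"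


section \<open>Linear connections\<close>

text \<open>The value \<open>D p v Y\<close> is the covariant derivative at \<open>p\<close> of the vector field \<open>Y\<close>, smooth near
  \<open>p\<close>, in the direction of the tangent vector \<open>v\<close> at \<open>p\<close>.\<close>

type_synonym ('m, 'e) connection = "'m \<Rightarrow> 'e \<Rightarrow> ('m \<Rightarrow> 'e) \<Rightarrow> 'e"

definition linear_connection ::
  "('m::topological_space, 'e::euclidean_space) chart set \<Rightarrow> ('m, 'e) connection \<Rightarrow> bool" where
  "linear_connection A D \<longleftrightarrow> (\<forall>U Y. open U \<longrightarrow> smooth_field_on A U Y \<longrightarrow>
     (\<forall>p\<in>U. linear (\<lambda>v. D p v Y)) \<and>
     (\<forall>Z. smooth_field_on A U Z \<longrightarrow>
        (\<forall>p\<in>U. \<forall>v. D p v (\<lambda>q. Y q + Z q) = D p v Y + D p v Z)) \<and>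
     (\<forall>f. smooth_fun_on A U f \<longrightarrow>
        (\<forall>p\<in>U. \<forall>v. D p v (\<lambda>q. f q *\<^sub>R Y q) = dir_deriv A p v f *\<^sub>R Y p + f p *\<^sub>R D p v Y)) \<and>
     (\<forall>Z. (\<forall>q\<in>U. Z q = Y q) \<longrightarrow> (\<forall>p\<in>U. \<forall>v. D p v Z = D p v Y)) \<and>
     (\<forall>X. smooth_field_on A U X \<longrightarrow> smooth_field_on A U (\<lambda>q. D q (X q) Y)))"

definition torsion ::
  "('m, 'e::euclidean_space) chart set \<Rightarrow> ('m, 'e) connection \<Rightarrow> 'm \<Rightarrow> ('m \<Rightarrow> 'e) \<Rightarrow> ('m \<Rightarrow> 'e) \<Rightarrow> 'e"
  where
  "torsion A D p X Y = D p (X p) Y - D p (Y p) X - lie_bracket A p X Y"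

definition levi_civita ::
  "('m::topological_space, 'e::euclidean_space) chart set \<Rightarrow> ('m \<Rightarrow> 'e \<Rightarrow> 'e \<Rightarrow> real) \<Rightarrow>
   ('m, 'e) connection \<Rightarrow> bool" where
  "levi_civita A g D \<longleftrightarrow> linear_connection A D \<and>
     (\<forall>U X Y. open U \<longrightarrow> smooth_field_on A U X \<longrightarrow> smooth_field_on A U Y \<longrightarrow>
        (\<forall>p\<in>U. torsion A D p X Y = 0)) \<and>
     (\<forall>U Y Z. open U \<longrightarrow> smooth_field_on A U Y \<longrightarrow> smooth_field_on A U Z \<longrightarrow>
        (\<forall>p\<in>U. \<forall>v. dir_deriv A p v (\<lambda>q. g q (Y q) (Z q)) = g p (D p v Y) (Z p) + g p (Y p) (D p v Z)))"

text \<open>The torsion as a \<open>(0,3)\<close>-tensor at \<open>p\<close>: the tangent vectors \<open>x\<close> and \<open>y\<close> are extended to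
  smooth vector fields near \<open>p\<close>.\<close>

definition torsion_tensor ::
  "('m::topological_space, 'e::euclidean_space) chart set \<Rightarrow> ('m \<Rightarrow> 'e \<Rightarrow> 'e \<Rightarrow> real) \<Rightarrow>
   ('m, 'e) connection \<Rightarrow> 'm \<Rightarrow> 'e tensor3" where
  "torsion_tensor A g D p x y z = g p (THE w. \<forall>U X Y. open U \<longrightarrow> p \<in> U \<longrightarrow>
     smooth_field_on A U X \<longrightarrow> smooth_field_on A U Y \<longrightarrow> X p = x \<longrightarrow> Y p = y \<longrightarrow>
     w = torsion A D p X Y) z"

text \<open>\<open>(\<nabla>\<^sub>v \<phi>) Y\<close> and \<open>(\<nabla>\<^sub>v \<eta>) Y\<close> at \<open>p\<close>.\<close>

definition cov_deriv_endo ::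
  "('m, 'e::euclidean_space) connection \<Rightarrow> ('m \<Rightarrow> 'e \<Rightarrow> 'e) \<Rightarrow> 'm \<Rightarrow> 'e \<Rightarrow> ('m \<Rightarrow> 'e) \<Rightarrow> 'e" where
  "cov_deriv_endo D \<phi> p v Y = D p v (\<lambda>q. \<phi> q (Y q)) - \<phi> p (D p v Y)"

definition cov_deriv_form ::
  "('m, 'e::euclidean_space) chart set \<Rightarrow> ('m, 'e) connection \<Rightarrow> ('m \<Rightarrow> 'e \<Rightarrow> real) \<Rightarrow>
   'm \<Rightarrow> 'e \<Rightarrow> ('m \<Rightarrow> 'e) \<Rightarrow> real" where
  "cov_deriv_form A D \<eta> p v Y = dir_deriv A p v (\<lambda>q. \<eta> q (Y q)) - \<eta> p (D p v Y)"


section \<open>Almost contact B-metric manifolds\<close>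

text \<open>Smoothness of the tensor fields \<open>\<phi>\<close>, \<open>\<eta>\<close>, \<open>g\<close> means that they yield smooth fields and
  functions when applied to smooth vector fields.\<close>

locale almost_contact_B_metric_manifold = smooth_manifold A
  for A :: "('m::{t2_space,second_countable_topology}, 'e::euclidean_space) chart set" +
  fixes n :: nat
    and \<phi> :: "'m \<Rightarrow> 'e \<Rightarrow> 'e"
    and \<xi> :: "'m \<Rightarrow> 'e"
    and \<eta> :: "'m \<Rightarrow> 'e \<Rightarrow> real"
    and g :: "'m \<Rightarrow> 'e \<Rightarrow> 'e \<Rightarrow> real"
  assumes pointwise: "almost_contact_B_metric_space n (\<phi> p) (\<xi> p) (\<eta> p) (g p)"
    and smooth_phi: "open U \<Longrightarrow> smooth_field_on A U X \<Longrightarrow> smooth_field_on A U (\<lambda>q. \<phi> q (X q))"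
    and smooth_xi: "smooth_field_on A UNIV \<xi>"
    and smooth_eta: "open U \<Longrightarrow> smooth_field_on A U X \<Longrightarrow> smooth_fun_on A U (\<lambda>q. \<eta> q (X q))"
    and smooth_g: "open U \<Longrightarrow> smooth_field_on A U X \<Longrightarrow> smooth_field_on A U Y \<Longrightarrow>
      smooth_fun_on A U (\<lambda>q. g q (X q) (Y q))"

definition phiB_connection ::
  "('m, 'e::euclidean_space) chart set \<Rightarrow> ('m \<Rightarrow> 'e \<Rightarrow> 'e) \<Rightarrow> ('m \<Rightarrow> 'e) \<Rightarrow> ('m \<Rightarrow> 'e \<Rightarrow> real) \<Rightarrow>
   ('m, 'e) connection \<Rightarrow> ('m, 'e) connection" where
  "phiB_connection A \<phi> \<xi> \<eta> D p x Y = D p x Y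
     + (1/2) *\<^sub>R (cov_deriv_endo D \<phi> p x (\<lambda>q. \<phi> q (Y q)) + cov_deriv_form A D \<eta> p x Y *\<^sub>R \<xi> p)
     - \<eta> p (Y p) *\<^sub>R D p x \<xi>"

end

theory Submission
  imports Defs
begin

text \<open>
  The statement says that the torsion \<open>T\<close> of the \<open>\<phi>\<close>B-connection has no component in
  \<open>\<W>\<^sub>1\<^sub>,\<^sub>1 = \<T>\<^sub>1 \<oplus> \<T>\<^sub>2\<close>. On \<open>ker \<eta>\<close> the endomorphism \<open>\<phi>\<close> is a complex structure, and
  \<open>\<W>\<^sub>1\<^sub>,\<^sub>1\<close> consists of the horizontal torsion tensors that are real parts of complex trilinear forms.
  The projection onto it is therefore
  \<open>1/4 {T(x,y,z) - T(\<phi>x,\<phi>y,z) - T(\<phi>x,y,\<phi>z) - T(x,\<phi>y,\<phi>z)}\<close>.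

  Since \<open>\<nabla>\<close> is torsion free, \<open>T(x,y) = Q(x,y) - Q(y,x)\<close>, where \<open>Q\<close> is the difference of the two
  connections. On horizontal vectors \<open>g(Q(x,y),z) = 1/2 g((\<nabla>\<^sub>x\<phi>)\<phi>y,z) =: b(x,y,z)\<close>. Differentiating
  \<open>\<phi>\<^sup>2 = -Id + \<eta>\<otimes>\<xi>\<close> shows that \<open>\<nabla>\<^sub>x\<phi>\<close> anticommutes with \<open>\<phi>\<close> on \<open>ker \<eta>\<close> up to multiples of
  \<open>\<xi>\<close>, and with the B-metric property this becomes \<open>b(x,\<phi>y,z) = -b(x,y,\<phi>z)\<close>. In the projection
  above the four terms coming from \<open>b(x,y,z)\<close> then cancel in pairs, and so do those from \<open>b(y,x,z)\<close>.
  This is lemma \<open>phiB_torsion_class\<close>.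

  Two further things are needed. First, a torsion tensor with vanishing projection has to be written
  explicitly as a sum of elements of the remaining classes (\<open>torsion_class_decomposition\<close>). Most
  components are eigenparts under the substitutions \<open>x \<mapsto> \<phi>x\<close> and under permutations of the
  arguments. Only the splittings of \<open>\<W>\<^sub>1\<^sub>,\<^sub>3\<close> and \<open>\<W>\<^sub>3\<^sub>,\<^sub>1\<close> require traces: the parts in \<open>\<T>\<^sub>4\<close>, \<open>\<T>\<^sub>9\<close>
  and \<open>\<T>\<^sub>1\<^sub>0\<close> are tensors built from the metric, \<open>\<phi>\<close> and a 1-form, and the inner product of such a
  tensor with any \<open>T\<close> is given by traces of \<open>T\<close> (\<open>tensor_inner_wedge_metric\<close>), which vanish on \<open>\<T>\<^sub>5\<close> and
  \<open>\<T>\<^sub>1\<^sub>1\<close>.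

  Second, \<open>(\<nabla>\<^sub>x\<phi>)Y\<close> at a point has to depend on the value of \<open>Y\<close> at this point only
  (\<open>cov_deriv_phi_tensorial\<close>), which makes the torsion a well-defined tensor. This is seen by
  expanding \<open>Y\<close> in the coordinate fields of a chart: the derivatives of the coefficients cancel.
  That coordinate fields and coefficients are smooth rests on the chain rule for \<open>C\<^sup>k\<close> maps.
\<close>


section \<open>Dual bases and contractions of bilinear forms\<close>

text \<open>The basis need only span a subspace, so that the same results serve for the tangent space and
  for \<open>ker \<eta>\<close>; they are also used with an auxiliary scalar product in place of the B-metric.\<close>

locale nondegenerate_basis =
  fixes g :: "'v::euclidean_space \<Rightarrow> 'v \<Rightarrow> real" and B :: "'v set"
  assumes bilinear: "bilinear g"
    and symmetric: "g x y = g y x"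
    and independent: "independent B"
    and nondegenerate: "x \<in> span B \<Longrightarrow> (\<And>y. y \<in> B \<Longrightarrow> g x y = 0) \<Longrightarrow> x = 0"
begin

lemma finite_basis: "finite B"
  using independent by (rule finiteI_independent)

lemma linear_left: "linear (\<lambda>x. g x y)" and linear_right: "linear (g x)"
  using bilinear unfolding bilinear_def by auto

lemma metric_eqI:
  assumes "x \<in> span B" "y \<in> span B" "\<And>c. c \<in> B \<Longrightarrow> g x c = g y c"
  shows "x = y"
proof -
  have "x - y = 0"
    using assms by (intro nondegenerate) (auto intro: span_diff simp: linear_diff[OF linear_left])
  then show ?thesis by simp
qed

lemma dual_vector_exists:
  assumes "a \<in> B"
  shows "\<exists>d\<in>span B. \<forall>c\<in>B. g d c = (if a = c then 1 else 0)"
proof -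
  \<comment> \<open>The Gram matrix as an endomorphism of the span; nondegeneracy makes it injective, hence onto.\<close>
  define L where "L x = (\<Sum>b\<in>B. g x b *\<^sub>R b)" for x
  have lin: "linear L"
    unfolding L_def
    by (intro linear_compose_sum ballI linearI)
       (simp_all add: linear_add[OF linear_left] linear_scale[OF linear_left] algebra_simps)
  have coefficients: "u = v" if "(\<Sum>b\<in>B. p b *\<^sub>R b) = (\<Sum>b\<in>B. q b *\<^sub>R b)" "u = p c" "v = q c" "c \<in> B"
    for p q :: "'v \<Rightarrow> real" and u v c
  proof -
    have "(\<Sum>b\<in>B. (p b - q b) *\<^sub>R b) = 0"
      using that(1) by (simp add: scaleR_diff_left sum_subtractf)
    then have "p c - q c = 0"
      using independentD[OF independent finite_basis subset_refl, of "\<lambda>b. p b - q b"] that(4) by blast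
    then show ?thesis using that by simp
  qed
  have "inj_on L (span B)"
  proof (rule inj_onI)
    fix x y assume x: "x \<in> span B" "y \<in> span B" "L x = L y"
    show "x = y"
      using coefficients[OF x(3)[unfolded L_def] refl refl] x(1,2) by (intro metric_eqI)
  qed
  then have "dim (L ` span B) = dim (span B)"
    by (simp only: dim_image_eq[OF lin] dim_span span_span)
  moreover have "L ` span B \<subseteq> span B"
    unfolding L_def by (intro image_subsetI span_sum span_scale span_base)
  ultimately have "L ` span B = span B"
    by (intro subspace_dim_equal linear_subspace_image[OF lin] subspace_span) auto
  then obtain d where d: "d \<in> span B" "L d = a"
    using assms by (metis image_iff span_base)
  have a: "a = (\<Sum>b\<in>B. (if a = b then 1 else 0) *\<^sub>R b)"
    using assms finite_basis by (simp add: if_distrib[where f="\<lambda>r. r *\<^sub>R _"] cong: if_cong)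
  show ?thesis
  proof (intro bexI[OF _ d(1)] ballI)
    fix c assume "c \<in> B"
    then show "g d c = (if a = c then 1 else 0)"
      using coefficients[OF d(2)[unfolded L_def, THEN trans, OF a] refl refl] by simp
  qed
qed

definition dual :: "'v \<Rightarrow> 'v" where
  "dual a = (\<Sum>b\<in>B. inverse_gram g B a b *\<^sub>R b)"

text \<open>The rows of the inverse Gram matrix are the coordinates of the dual basis vectors, which exist
  and are unique by nondegeneracy.\<close>

lemma inverse_gram_unique:
  "\<exists>!h. (\<forall>a\<in>B. \<forall>c\<in>B. (\<Sum>b\<in>B. h a b * g b c) = (if a = c then 1 else 0)) \<and>
     (\<forall>a b. a \<notin> B \<or> b \<notin> B \<longrightarrow> h a b = 0)"
proof -
  have "\<exists>d. \<forall>a\<in>B. d a \<in> span B \<and> (\<forall>c\<in>B. g (d a) c = (if a = c then 1 else 0))"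
    using dual_vector_exists by (intro bchoice ballI) blast
  then obtain d where d: "\<And>a. a \<in> B \<Longrightarrow> d a \<in> span B"
    "\<And>a c. a \<in> B \<Longrightarrow> c \<in> B \<Longrightarrow> g (d a) c = (if a = c then 1 else 0)" by metis
  have "\<exists>k. d a = (\<Sum>b\<in>B. k b *\<^sub>R b)" if "a \<in> B" for a
    using d(1)[OF that] unfolding span_finite[OF finite_basis] by auto
  then obtain k where k: "\<And>a. a \<in> B \<Longrightarrow> d a = (\<Sum>b\<in>B. k a b *\<^sub>R b)" by metis
  define h where "h a b = (if a \<in> B \<and> b \<in> B then k a b else 0)" for a b
  have expand: "g (\<Sum>b\<in>B. h a b *\<^sub>R b) c = (\<Sum>b\<in>B. h a b * g b c)" for h :: "'v \<Rightarrow> 'v \<Rightarrow> real" and a c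
    by (simp add: linear_sum[OF linear_left] linear_scale[OF linear_left])
  have h: "(\<Sum>b\<in>B. h a b *\<^sub>R b) = d a" if "a \<in> B" for a
    using that by (simp add: k h_def)
  show ?thesis
  proof (rule ex1I[of _ h])
    show "(\<forall>a\<in>B. \<forall>c\<in>B. (\<Sum>b\<in>B. h a b * g b c) = (if a = c then 1 else 0)) \<and>
      (\<forall>a b. a \<notin> B \<or> b \<notin> B \<longrightarrow> h a b = 0)"
      by (auto simp: expand[symmetric] h d(2)) (auto simp: h_def)
    fix h' assume h': "(\<forall>a\<in>B. \<forall>c\<in>B. (\<Sum>b\<in>B. h' a b * g b c) = (if a = c then 1 else 0)) \<and>
      (\<forall>a b. a \<notin> B \<or> b \<notin> B \<longrightarrow> h' a b = 0)"
    show "h' = h"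
    proof (intro ext)
      fix a b
      show "h' a b = h a b"
      proof (cases "a \<in> B \<and> b \<in> B")
        case True
        have "(\<Sum>b\<in>B. h' a b *\<^sub>R b) = (\<Sum>b\<in>B. h a b *\<^sub>R b)"
          using True h' d(2) by (intro metric_eqI span_sum span_scale span_base) (auto simp: expand h)
        then have "(\<Sum>b\<in>B. (h' a b - h a b) *\<^sub>R b) = 0"
          by (simp add: scaleR_diff_left sum_subtractf)
        then show ?thesis
          using independentD[OF independent finite_basis subset_refl, of "\<lambda>b. h' a b - h a b"] True
          by auto
      next
        case False
        then show ?thesis using h' by (auto simp: h_def)
      qed
    qed
  qed
qed

lemma dual_in_span: "dual a \<in> span B"
  unfolding dual_def by (intro span_sum span_scale span_base)

lemma metric_dual:
  assumes "a \<in> B" "c \<in> B"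
  shows "g (dual a) c = (if a = c then 1 else 0)"
  using theI'[OF inverse_gram_unique] assms unfolding inverse_gram_def[symmetric]
  by (simp add: dual_def linear_sum[OF linear_left] linear_scale[OF linear_left])

lemma expand_in_dual:
  assumes "x \<in> span B"
  shows "(\<Sum>a\<in>B. g x a *\<^sub>R dual a) = x"
proof (rule metric_eqI[OF _ assms])
  show "(\<Sum>a\<in>B. g x a *\<^sub>R dual a) \<in> span B"
    by (intro span_sum span_scale dual_in_span)
  fix c assume "c \<in> B"
  then show "g (\<Sum>a\<in>B. g x a *\<^sub>R dual a) c = g x c"
    using finite_basis
    by (simp add: linear_sum[OF linear_left] linear_scale[OF linear_left] metric_dual
        if_distrib[where f="\<lambda>r. _ * r"] cong: if_cong)
qed

lemma expand_in_basis:
  assumes "x \<in> span B"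
  shows "(\<Sum>a\<in>B. g x (dual a) *\<^sub>R a) = x"
proof -
  obtain k where k: "x = (\<Sum>b\<in>B. k b *\<^sub>R b)"
    using assms unfolding span_finite[OF finite_basis] by auto
  have "g x (dual a) = k a" if "a \<in> B" for a
    using that finite_basis
    by (simp add: k linear_sum[OF linear_right] linear_scale[OF linear_right] symmetric[of _ "dual a"]
        metric_dual if_distrib[where f="\<lambda>r. _ * r"] cong: if_cong)
  then show ?thesis using k by simp
qed

lemma contract_dual:
  assumes "linear l" "x \<in> span B"
  shows "(\<Sum>a\<in>B. g x a * l (dual a)) = l x"
proof -
  have "l x = l (\<Sum>a\<in>B. g x a *\<^sub>R dual a)" using expand_in_dual[OF assms(2)] by simp
  then show ?thesis by (simp add: linear_sum[OF assms(1)] linear_scale[OF assms(1)])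
qed

lemma contract_basis:
  assumes "linear l" "x \<in> span B"
  shows "(\<Sum>a\<in>B. g x (dual a) * l a) = l x"
proof -
  have "l x = l (\<Sum>a\<in>B. g x (dual a) *\<^sub>R a)" using expand_in_basis[OF assms(2)] by simp
  then show ?thesis by (simp add: linear_sum[OF assms(1)] linear_scale[OF assms(1)])
qed

definition contraction :: "('v \<Rightarrow> 'v \<Rightarrow> real) \<Rightarrow> real" where
  "contraction S = (\<Sum>a\<in>B. S a (dual a))"

lemma contraction_gram:
  assumes "\<And>x. linear (S x)"
  shows "contraction S = (\<Sum>i\<in>B. \<Sum>j\<in>B. inverse_gram g B i j * S i j)"
  by (simp add: contraction_def dual_def linear_sum[OF assms] linear_scale[OF assms])

lemma contraction_adjoint:
  assumes "\<And>x. linear (S x)" "\<And>y. linear (\<lambda>x. S x y)"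
    and "\<And>x y. x \<in> span B \<Longrightarrow> y \<in> span B \<Longrightarrow> P x \<in> span B \<and> Q y \<in> span B \<and> g (P x) y = g x (Q y)"
  shows "contraction (\<lambda>x y. S (P x) y) = contraction (\<lambda>x y. S x (Q y))"
proof -
  note d = dual_in_span
  have "contraction (\<lambda>x y. S (P x) y) = (\<Sum>a\<in>B. \<Sum>b\<in>B. g (P a) (dual b) * S b (dual a))"
    unfolding contraction_def
    by (intro sum.cong refl contract_basis[symmetric] assms conjunct1[OF assms(3)] span_base d)
  also have "\<dots> = (\<Sum>b\<in>B. \<Sum>a\<in>B. g (Q (dual b)) a * S b (dual a))"
    by (subst sum.swap, intro sum.cong refl)
       (simp add: assms(3) d span_base symmetric[of _ "Q _"])
  also have "\<dots> = contraction (\<lambda>x y. S x (Q y))"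
    unfolding contraction_def
    using assms(3) d span_zero by (intro sum.cong refl contract_dual assms(1)) blast
  finally show ?thesis .
qed

lemma contraction_flip:
  assumes "\<And>x. linear (S x)" "\<And>y. linear (\<lambda>x. S x y)"
  shows "contraction (\<lambda>x y. S y x) = contraction S"
proof -
  note d = dual_in_span
  have "contraction (\<lambda>x y. S y x) = (\<Sum>a\<in>B. \<Sum>b\<in>B. g (dual a) (dual b) * S b a)"
    unfolding contraction_def
    by (intro sum.cong refl contract_basis[symmetric] assms d)
  also have "\<dots> = (\<Sum>b\<in>B. \<Sum>a\<in>B. g (dual b) (dual a) * S b a)"
    by (subst sum.swap) (simp add: symmetric[of "dual _" "dual _"])
  also have "\<dots> = contraction S"
    unfolding contraction_def by (intro sum.cong refl contract_basis assms d)
  finally show ?thesis .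
qed

lemma contraction_metric: "contraction g = card B"
  by (simp add: contraction_def symmetric[of _ "dual _"] metric_dual)

end

text \<open>A trace over a large space reduces to one over a subspace onto which \<open>P\<close> projects
  orthogonally, if \<open>S\<close> factors through \<open>P\<close>: expand \<open>P a\<close> in the smaller basis and sum over the
  larger one. Bases of the whole tangent space, used for the inner product of tensors, are compared
  in this way with the bases of \<open>ker \<eta>\<close> that define the trace forms.\<close>

lemma contraction_projection:
  assumes B: "nondegenerate_basis g B" and C: "nondegenerate_basis g C"
    and S: "\<And>x. linear (S x)" "\<And>y. linear (\<lambda>x. S x y)"
    and C_B: "span C \<subseteq> span B"
    and P: "\<And>x. x \<in> span B \<Longrightarrow> P x \<in> span C" "\<And>x y. x \<in> span B \<Longrightarrow> y \<in> span C \<Longrightarrow> g (P x) y = g x y"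
      "\<And>x y. x \<in> span B \<Longrightarrow> S (P x) y = S x y"
  shows "nondegenerate_basis.contraction g B S = nondegenerate_basis.contraction g C S"
proof -
  interpret B: nondegenerate_basis g B by (rule B)
  interpret C: nondegenerate_basis g C by (rule C)
  have "B.contraction S = (\<Sum>a\<in>B. S (P a) (B.dual a))"
    by (simp add: B.contraction_def P(3) span_base)
  also have "\<dots> = (\<Sum>a\<in>B. \<Sum>c\<in>C. g (P a) (C.dual c) * S c (B.dual a))"
    by (intro sum.cong refl C.contract_basis[symmetric] S P(1) span_base)
  also have "\<dots> = (\<Sum>c\<in>C. \<Sum>a\<in>B. g (C.dual c) a * S c (B.dual a))"
    by (subst sum.swap, intro sum.cong refl)
       (metis P(2) span_base C.dual_in_span B.symmetric)
  also have "\<dots> = C.contraction S"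
    unfolding C.contraction_def
    using C_B C.dual_in_span by (intro sum.cong refl B.contract_dual S) blast
  finally show ?thesis .
qed

text \<open>The trace of an endomorphism does not depend on the metric used to compute it. With respect to
  the scalar product \<open>x \<bullet> y + Jx \<bullet> Jy\<close> the complex structure is skew, so its trace is zero.\<close>

lemma trace_complex_structure_zero:
  assumes "nondegenerate_basis g B" and J: "linear J"
    and J_span: "\<And>x. x \<in> span B \<Longrightarrow> J x \<in> span B" and JJ: "\<And>x. x \<in> span B \<Longrightarrow> J (J x) = - x"
  shows "nondegenerate_basis.contraction g B (\<lambda>x y. g (J x) y) = 0"
proof -
  interpret nondegenerate_basis g B by fact
  define k where "k x y = x \<bullet> y + J x \<bullet> J y" for x y
  interpret k: nondegenerate_basis k B
  proof
    show "bilinear k"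
      unfolding bilinear_def k_def
      by (auto intro!: linearI simp: linear_add[OF J] linear_scale[OF J] inner_simps algebra_simps)
    show "k x y = k y x" for x y by (simp add: k_def inner_commute)
    show "independent B" by (rule independent)
    fix x assume x: "x \<in> span B" "\<And>y. y \<in> B \<Longrightarrow> k x y = 0"
    have "linear (k x)" using \<open>bilinear k\<close> by (simp add: bilinear_def)
    then have "k x x = 0"
      using linear_eq_0_on_span[of "k x" B x] x by blast
    then have "x \<bullet> x + J x \<bullet> J x = 0" by (simp add: k_def)
    then show "x = 0" by (metis add_nonneg_eq_0_iff inner_eq_zero_iff inner_ge_zero)
  qed
  have coordinate: "g x (dual b) = k x (k.dual b)" if "x \<in> span B" "b \<in> B" for x b
  proof -
    have "(\<Sum>a\<in>B. (g x (dual a) - k x (k.dual a)) *\<^sub>R a) = 0"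
      using expand_in_basis[OF that(1)] k.expand_in_basis[OF that(1)]
      by (simp add: scaleR_diff_left sum_subtractf)
    then show ?thesis
      using independentD[OF independent finite_basis subset_refl, of "\<lambda>a. g x (dual a) - k x (k.dual a)"]
        that(2) by auto
  qed
  have skew: "k x (J y) = - k (J x) y" if "x \<in> span B" "y \<in> span B" for x y
    using that by (simp add: k_def JJ)
  have lin: "linear (\<lambda>x. k (J x) y)" "linear (k (J x))" "linear (\<lambda>x. k x y)" for x y
    using linear_compose[OF J k.linear_left] k.linear_right k.linear_left by (simp_all add: o_def)
  have "contraction (\<lambda>x y. g (J x) y) = k.contraction (\<lambda>x y. k (J x) y)"
    by (simp add: contraction_def k.contraction_def coordinate J_span span_base)
  also have "\<dots> = k.contraction (\<lambda>x y. k (J y) x)"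
    by (rule k.contraction_flip[symmetric]) (rule lin)+
  also have "\<dots> = - k.contraction (\<lambda>x y. k (J x) y)"
    unfolding k.contraction_def sum_negf[symmetric]
    by (intro sum.cong refl) (simp add: k.symmetric[of "J (k.dual _)"] skew span_base k.dual_in_span)
  finally show ?thesis
    by (simp add: contraction_def k.contraction_def coordinate J_span span_base)
qed

section \<open>Traces and inner products of torsion tensors\<close>

lemma some_basis:
  assumes "subspace W"
  shows "independent (some_basis W)" "span (some_basis W) = W"
proof -
  obtain B where "B \<subseteq> W" "independent B" "W \<subseteq> span B"
    using basis_exists by metis
  then have "independent B \<and> span B = W"
    using span_subspace[OF _ _ assms] by blast
  then have "independent (some_basis W) \<and> span (some_basis W) = W"
    unfolding some_basis_def by (rule someI)
  then show "independent (some_basis W)" "span (some_basis W) = W" by auto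
qed

lemma torsion_tensorsI:
  assumes "\<And>x x' y z. T (x + x') y z = T x y z + T x' y z"
    and "\<And>c x y z. T (c *\<^sub>R x) y z = c * T x y z"
    and "\<And>x y z z'. T x y (z + z') = T x y z + T x y z'"
    and "\<And>c x y z. T x y (c *\<^sub>R z) = c * T x y z"
    and "\<And>x y z. T x y z = - T y x z"
  shows "T \<in> torsion_tensors"
proof -
  have "linear (\<lambda>x. T x y z)" "linear (T x y)" for x y z
    using assms(1-4) by (auto intro!: linearI)
  moreover have "linear (\<lambda>y. T x y z)" for x z
  proof -
    have "(\<lambda>y. T x y z) = (\<lambda>y. - T y x z)" using assms(5) by blast
    then show ?thesis using calculation(1)[of x z] by (simp add: linear_compose_neg)
  qed
  ultimately show ?thesis using assms(5) unfolding torsion_tensors_def by blast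
qed

lemma torsion_tensors_linear:
  assumes "T \<in> torsion_tensors"
  shows "linear (\<lambda>x. T x y z)" "linear (\<lambda>y. T x y z)" "linear (T x y)"
  using assms unfolding torsion_tensors_def by blast+

lemma torsion_tensors_antisym: "T \<in> torsion_tensors \<Longrightarrow> T x y z = - T y x z"
  unfolding torsion_tensors_def by blast

lemma torsion_tensors_diff:
  assumes "T \<in> torsion_tensors" "S \<in> torsion_tensors"
  shows "(\<lambda>x y z. T x y z - S x y z) \<in> torsion_tensors"
proof -
  have "T x y z - S x y z = - (T y x z - S y x z)" for x y z
    using assms[THEN torsion_tensors_antisym, of x y z] by simp
  then show ?thesis
    unfolding torsion_tensors_def
    by (intro CollectI conjI allI linear_compose_sub torsion_tensors_linear[OF assms(1)]
        torsion_tensors_linear[OF assms(2)]) blast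
qed

lemmas linear_simps = linear_add linear_diff linear_neg linear_0 linear_scale

lemma torsion_tensors_simps:
  assumes "T \<in> torsion_tensors"
  shows "T (x + x') y z = T x y z + T x' y z" "T (x - x') y z = T x y z - T x' y z"
    "T (- x) y z = - T x y z" "T 0 y z = 0" "T (c *\<^sub>R x) y z = c * T x y z"
    "T x (y + y') z = T x y z + T x y' z" "T x (y - y') z = T x y z - T x y' z"
    "T x (- y) z = - T x y z" "T x 0 z = 0" "T x (c *\<^sub>R y) z = c * T x y z"
    "T x y (z + z') = T x y z + T x y z'" "T x y (z - z') = T x y z - T x y z'"
    "T x y (- z) = - T x y z" "T x y 0 = 0" "T x y (c *\<^sub>R z) = c * T x y z"
  using torsion_tensors_linear(1)[OF assms, of y z, THEN linear_simps(1)]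
    torsion_tensors_linear(1)[OF assms, of y z, THEN linear_simps(2)]
    torsion_tensors_linear(1)[OF assms, of y z, THEN linear_simps(3)]
    torsion_tensors_linear(1)[OF assms, of y z, THEN linear_simps(4)]
    torsion_tensors_linear(1)[OF assms, of y z, THEN linear_simps(5)]
    torsion_tensors_linear(2)[OF assms, of x z, THEN linear_simps(1)]
    torsion_tensors_linear(2)[OF assms, of x z, THEN linear_simps(2)]
    torsion_tensors_linear(2)[OF assms, of x z, THEN linear_simps(3)]
    torsion_tensors_linear(2)[OF assms, of x z, THEN linear_simps(4)]
    torsion_tensors_linear(2)[OF assms, of x z, THEN linear_simps(5)]
    torsion_tensors_linear(3)[OF assms, of x y, THEN linear_simps(1)]
    torsion_tensors_linear(3)[OF assms, of x y, THEN linear_simps(2)]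
    torsion_tensors_linear(3)[OF assms, of x y, THEN linear_simps(3)]
    torsion_tensors_linear(3)[OF assms, of x y, THEN linear_simps(4)]
    torsion_tensors_linear(3)[OF assms, of x y, THEN linear_simps(5)]
  by simp_all

context almost_contact_B_metric_space
begin

text \<open>The orthogonal projection onto \<open>ker \<eta>\<close>, equal to \<open>-\<phi>\<^sup>2\<close>.\<close>

definition hor :: "'v \<Rightarrow> 'v" where "hor x = x - \<eta> x *\<^sub>R \<xi>"

lemmas phi_linear = linear_simps[OF linear_phi]
lemmas eta_linear = linear_simps[OF linear_eta]

lemma linear_hor: "linear hor"
  unfolding hor_def by (intro linearI) (simp_all add: eta_linear algebra_simps)

lemma linear_g_left: "linear (\<lambda>x. g x y)" and linear_g_right: "linear (g x)"
  using bilinear_g unfolding bilinear_def by auto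

lemmas hor_linear = linear_simps[OF linear_hor]
lemmas g_linear = linear_simps[OF linear_g_left] linear_simps[OF linear_g_right]

lemma hor_simps:
  "\<phi> (\<phi> x) = - hor x" "\<phi> (hor x) = \<phi> x" "hor (\<phi> x) = \<phi> x" "hor (hor x) = hor x"
  "hor \<xi> = 0" "\<phi> \<xi> = 0" "\<eta> (hor x) = 0" "\<eta> (\<phi> x) = 0" "\<eta> \<xi> = 1"
  by (simp_all add: hor_def phi_phi phi_linear phi_xi eta_phi eta_linear eta_xi)

lemma g_xi: "g x \<xi> = \<eta> x"
  using g_phi_phi[of x \<xi>] by (simp add: phi_xi eta_xi g_linear)

lemma g_phi: "g (\<phi> x) y = g x (\<phi> y)"
  using g_phi_phi[of x "\<phi> y"] by (simp add: phi_phi g_linear g_xi eta_phi)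

lemma g_hor: "g (hor x) y = g x (hor y)"
  using sym_g[of \<xi> y] by (simp add: hor_def g_linear g_xi)

lemma hor_id: "\<eta> x = 0 \<Longrightarrow> hor x = x"
  by (simp add: hor_def)

lemma g_nondegenerate:
  assumes "\<And>y. g x y = 0"
  shows "x = 0"
proof -
  obtain P N where PN: "finite P" "finite N" "P \<inter> N = {}" "span (P \<union> N) = UNIV"
    "\<forall>b\<in>P. g b b = 1" "\<forall>b\<in>N. g b b = -1" "\<forall>b\<in>P \<union> N. \<forall>c\<in>P \<union> N. b \<noteq> c \<longrightarrow> g b c = 0"
    using signature_g unfolding has_signature_def by blast
  have fin: "finite (P \<union> N)" using PN by simp
  have "x \<in> span (P \<union> N)" using PN by simp
  then obtain k where k: "x = (\<Sum>b\<in>P \<union> N. k b *\<^sub>R b)"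
    unfolding span_finite[OF fin] by auto
  have "k c = 0" if c: "c \<in> P \<union> N" for c
  proof -
    have "g x c = (\<Sum>b\<in>P \<union> N. k b * g b c)"
      unfolding k by (simp add: linear_sum[OF linear_g_left] linear_scale[OF linear_g_left])
    also have "\<dots> = (\<Sum>b\<in>P \<union> N. if b = c then k c * g c c else 0)"
      using PN(7) c by (intro sum.cong) auto
    also have "\<dots> = k c * g c c" using c fin by simp
    finally show ?thesis using assms[of c] PN(5,6) c by auto
  qed
  then show ?thesis using k by simp
qed

abbreviation ker_eta :: "'v set" where "ker_eta \<equiv> {v. \<eta> v = 0}"

lemma subspace_ker_eta: "subspace ker_eta"
  by (auto intro!: subspaceI simp: eta_linear)

lemma tangent_basis: "nondegenerate_basis g (some_basis UNIV)"
proof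
  show "bilinear g" "g x y = g y x" for x y by (rule bilinear_g sym_g)+
  show "independent (some_basis (UNIV :: 'v set))" by (rule some_basis) simp
  fix x assume "\<And>y. y \<in> some_basis UNIV \<Longrightarrow> g x y = 0"
  then have "g x y = 0" for y
    using linear_eq_0_on_span[OF linear_g_right, of "some_basis UNIV" x y] some_basis(2)[of "UNIV :: 'v set"] by simp
  then show "x = 0" by (rule g_nondegenerate)
qed

lemma horizontal_basis: "nondegenerate_basis g (some_basis ker_eta)"
proof
  note B = some_basis[OF subspace_ker_eta]
  show "bilinear g" "g x y = g y x" for x y by (rule bilinear_g sym_g)+
  show "independent (some_basis ker_eta)" by (rule B)
  fix x assume x: "x \<in> span (some_basis ker_eta)" "\<And>y. y \<in> some_basis ker_eta \<Longrightarrow> g x y = 0"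
  have "g x y = 0" for y
  proof -
    have "hor y \<in> span (some_basis ker_eta)" using B by (simp add: hor_simps)
    then have "g x (hor y) = 0"
      using linear_eq_0_on_span[OF linear_g_right] x(2) by blast
    moreover have "hor x = x" using x(1) B by (simp add: hor_id)
    ultimately show ?thesis using g_hor[of x y] by simp
  qed
  then show "x = 0" by (rule g_nondegenerate)
qed

interpretation U: nondegenerate_basis g "some_basis UNIV" by (rule tangent_basis)
interpretation H: nondegenerate_basis g "some_basis ker_eta" by (rule horizontal_basis)

lemmas span_H = some_basis(2)[OF subspace_ker_eta]

lemma span_U: "span (some_basis (UNIV :: 'v set)) = UNIV"
  by (rule some_basis) simp

lemma eta_H: "a \<in> some_basis ker_eta \<Longrightarrow> \<eta> a = 0" "\<eta> (H.dual a) = 0"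
  using span_H span_base[of a "some_basis ker_eta"] H.dual_in_span[of a] by auto

lemma hor_H: "a \<in> some_basis ker_eta \<Longrightarrow> hor a = a" "hor (H.dual a) = H.dual a"
  using eta_H by (auto intro: hor_id)

lemma t_form_contraction:
  assumes "T \<in> torsion_tensors"
  shows "t_form T x = H.contraction (T x)"
  unfolding t_form_def metric_trace_def
  by (rule H.contraction_gram[symmetric]) (rule torsion_tensors_linear[OF assms])

lemma t_star_form_contraction:
  assumes "T \<in> torsion_tensors"
  shows "t_star_form T x = H.contraction (\<lambda>a b. T x a (\<phi> b))"
  unfolding t_star_form_def metric_trace_def
  using linear_compose[OF linear_phi torsion_tensors_linear(3)[OF assms]]
  by (intro H.contraction_gram[symmetric]) (simp add: o_def)

lemma contraction_U_H:
  assumes "\<And>x. linear (S x)" "\<And>y. linear (\<lambda>x. S x y)" "\<And>y. S \<xi> y = 0"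
  shows "U.contraction S = H.contraction S"
proof (rule contraction_projection[OF tangent_basis horizontal_basis assms(1,2)])
  show "g (hor x) y = g x y" if "y \<in> span (some_basis ker_eta)" for x y
    using that by (simp add: g_hor span_H hor_id)
  show "S (hor x) y = S x y" for x y
    using assms(3) by (simp add: hor_def linear_diff[OF assms(2)] linear_scale[OF assms(2)])
qed (auto simp: span_H span_U hor_simps)

lemma tensor_inner_dual:
  assumes "T \<in> torsion_tensors"
  shows "tensor_inner g R T = (\<Sum>i\<in>some_basis UNIV. \<Sum>j\<in>some_basis UNIV. \<Sum>k\<in>some_basis UNIV.
    R i j k * T (U.dual i) (U.dual j) (U.dual k))"
proof -
  note lin = torsion_tensors_linear[OF assms]
  have "T (U.dual i) (U.dual j) (U.dual k) = (\<Sum>q\<in>some_basis UNIV. \<Sum>r\<in>some_basis UNIV. \<Sum>s\<in>some_basis UNIV.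
      inverse_gram g (some_basis UNIV) i q * inverse_gram g (some_basis UNIV) j r *
      inverse_gram g (some_basis UNIV) k s * T q r s)" for i j k
  proof -
    let ?h = "inverse_gram g (some_basis UNIV)"
    have "l (U.dual a) = (\<Sum>b\<in>some_basis UNIV. ?h a b * l b)" if "linear l" for l :: "'v \<Rightarrow> real" and a
      by (simp add: U.dual_def linear_sum[OF that] linear_scale[OF that])
    note expand = this[OF lin(1)] this[OF lin(2)] this[OF lin(3)]
    show ?thesis
      by (subst expand(1), subst expand(2), subst expand(3)) (simp add: sum_distrib_left mult.assoc)
  qed
  then show ?thesis
    unfolding tensor_inner_def Let_def by (simp add: sum_distrib_left mult_ac)
qed

lemma tensor_inner_add: "tensor_inner g (\<lambda>x y z. R x y z + R' x y z) T = tensor_inner g R T + tensor_inner g R' T"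
  unfolding tensor_inner_def Let_def by (simp add: sum.distrib algebra_simps)

lemma tensor_inner_scale: "tensor_inner g (\<lambda>x y z. c * R x y z) T = c * tensor_inner g R T"
  unfolding tensor_inner_def Let_def by (simp add: sum_distrib_left mult_ac)

text \<open>The elements of \<open>\<T>\<^sub>4\<close>, \<open>\<T>\<^sub>9\<close> and \<open>\<T>\<^sub>1\<^sub>0\<close> are combinations of tensors of this form, with \<open>P\<close> the
  horizontal projection or \<open>\<phi>\<close>.\<close>

definition wedge_metric :: "('v \<Rightarrow> real) \<Rightarrow> ('v \<Rightarrow> 'v) \<Rightarrow> 'v tensor3" where
  "wedge_metric l P x y z = l y * g (P x) z - l x * g (P y) z"

text \<open>The factor \<open>g (P x) z\<close> contracts the last argument of \<open>T\<close> with the first or second one, and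
  both contractions agree up to sign by antisymmetry. Hence orthogonality to such tensors follows
  from the vanishing of traces of \<open>T\<close>.\<close>

lemma tensor_inner_wedge_metric:
  assumes T: "T \<in> torsion_tensors" and P: "linear P"
  shows "tensor_inner g (wedge_metric l P) T =
    - 2 * (\<Sum>j\<in>some_basis UNIV. l j * U.contraction (\<lambda>a b. T (U.dual j) a (P b)))"
proof -
  note lin = torsion_tensors_linear[OF T]
  note asym = torsion_tensors_antisym[OF T]
  let ?B = "some_basis (UNIV :: 'v set)"
  have linP: "linear (\<lambda>x. T w a (P x))" for w a
    using linear_compose[OF P lin(3)] by (simp add: o_def)
  have flip: "(\<Sum>i\<in>?B. T w (U.dual i) (P i)) = U.contraction (\<lambda>a b. T w a (P b))" for w
    using U.contraction_flip[of "\<lambda>a b. T w a (P b)"] linP lin(2)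
    by (simp add: U.contraction_def)
  have inner: "(\<Sum>k\<in>?B. c * g v k * T a b (U.dual k)) = c * T a b v" for c v a b
    using U.contract_dual[OF lin(3), of v a b] by (simp add: span_U sum_distrib_left[symmetric] mult.assoc)
  have "tensor_inner g (wedge_metric l P) T =
      (\<Sum>i\<in>?B. \<Sum>j\<in>?B. \<Sum>k\<in>?B. l j * g (P i) k * T (U.dual i) (U.dual j) (U.dual k)) -
      (\<Sum>i\<in>?B. \<Sum>j\<in>?B. \<Sum>k\<in>?B. l i * g (P j) k * T (U.dual i) (U.dual j) (U.dual k))"
    unfolding tensor_inner_dual[OF T] wedge_metric_def
    by (simp add: sum_subtractf left_diff_distrib)
  also have "\<dots> = (\<Sum>i\<in>?B. \<Sum>j\<in>?B. l j * T (U.dual i) (U.dual j) (P i)) -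
      (\<Sum>i\<in>?B. \<Sum>j\<in>?B. l i * T (U.dual i) (U.dual j) (P j))"
    by (simp only: inner)
  also have "(\<Sum>i\<in>?B. \<Sum>j\<in>?B. l j * T (U.dual i) (U.dual j) (P i)) =
      (\<Sum>j\<in>?B. \<Sum>i\<in>?B. - (l j * T (U.dual j) (U.dual i) (P i)))"
    by (subst sum.swap, intro sum.cong refl) (subst asym, simp)
  finally show ?thesis
    by (simp add: sum_negf sum_distrib_left[symmetric] flip)
qed

lemma trace_phi_zero: "H.contraction (\<lambda>x y. g (\<phi> x) y) = 0"
  by (rule trace_complex_structure_zero[OF horizontal_basis linear_phi])
     (auto simp: span_H hor_simps hor_id)

lemma contraction_phi_adjoint:
  assumes "\<And>x. linear (S x)" "\<And>y. linear (\<lambda>x. S x y)"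
  shows "H.contraction (\<lambda>a b. S a (\<phi> b)) = H.contraction (\<lambda>a b. S (\<phi> a) b)"
  by (rule H.contraction_adjoint[symmetric]) (auto simp: assms span_H hor_simps g_phi)

text \<open>On \<open>\<W>\<^sub>1\<^sub>,\<^sub>3\<close> this gives \<open>t\<^sup>* = 0\<close> as soon as \<open>t = 0\<close>, in particular on \<open>\<T>\<^sub>5\<close>.\<close>

lemma t_form_phi:
  assumes "T \<in> torsion_tensors" "\<And>y z. T \<xi> y z = 0" "\<And>x y z. T (\<phi> x) (\<phi> y) z = T x y z"
  shows "t_form T (\<phi> x) = - t_star_form T x"
proof -
  have "T (\<phi> x) y z = - T x (\<phi> y) z" for y z
    using assms(3)[of "\<phi> x" y z] assms(2)
    by (simp add: hor_simps(1)) (simp add: hor_def torsion_tensors_simps[OF assms(1)])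
  then have "t_form T (\<phi> x) = - H.contraction (\<lambda>a b. T x (\<phi> a) b)"
    by (simp add: t_form_contraction[OF assms(1)] H.contraction_def sum_negf)
  then show ?thesis
    using torsion_tensors_linear[OF assms(1)]
    by (simp add: t_star_form_contraction[OF assms(1)] contraction_phi_adjoint)
qed

section \<open>Splitting off the trace parts\<close>

lemma W13I:
  assumes "T \<in> torsion_tensors" "\<And>y z. T \<xi> y z = 0" "\<And>x y. T x y \<xi> = 0"
    "\<And>x y z. T (\<phi> x) (\<phi> y) z = T x y z" "\<And>x y z. cyclic_sum T x y z = 0"
  shows "T \<in> W13"
  using assms unfolding W13_def by simp

lemma W13D:
  assumes "T \<in> W13"
  shows "T \<in> torsion_tensors" "T \<xi> y z = 0" "T x y \<xi> = 0"
    "T (\<phi> x) (\<phi> y) z = T x y z" "cyclic_sum T x y z = 0"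
  using assms unfolding W13_def by (simp_all only: mem_Collect_eq right_minus_eq)

text \<open>The \<open>\<T>\<^sub>4\<close>-part is
  \<open>S(x,y,z) = \<theta>(y)g(x,z) - \<theta>(x)g(y,z) + \<theta>(\<phi>y)g(\<phi>x,z) - \<theta>(\<phi>x)g(\<phi>y,z)\<close> on \<open>ker \<eta>\<close>. Its trace is
  \<open>-m \<theta>\<close> with \<open>m = dim ker \<eta>\<close>: of the four terms, the first gives \<open>\<theta>\<close>, the second \<open>-m \<theta>\<close>, the
  third \<open>\<theta> \<circ> \<phi>\<^sup>2 = -\<theta>\<close>, and the fourth contains the trace of \<open>\<phi>\<close>, which is zero.
  So \<open>\<theta> = -t/m\<close> makes the remainder trace free. If \<open>m = 0\<close> then \<open>t = 0\<close>, in accordance with the value \<open>0\<close> of a division by zero.\<close>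

lemma W13_split:
  assumes T: "T \<in> W13"
  shows "\<exists>S\<in>T4. \<exists>R\<in>T5. \<forall>x y z. T x y z = S x y z + R x y z"
proof -
  have T_torsion: "T \<in> torsion_tensors" and T_xi: "\<And>y z. T \<xi> y z = 0" "\<And>x y. T x y \<xi> = 0"
    by (rule W13D[OF T])+
  define m where "m = real (card (some_basis ker_eta))"
  define th where "th x = - t_form T x / m" for x
  have th: "linear th"
    unfolding th_def t_form_contraction[OF T_torsion] H.contraction_def
    by (intro linearI) (simp_all add: torsion_tensors_simps[OF T_torsion] sum.distrib sum_distrib_left
        add_divide_distrib diff_divide_distrib)
  note th_simps = linear_simps[OF th]
  have th_xi: "th \<xi> = 0"
    by (simp add: th_def t_form_contraction[OF T_torsion] H.contraction_def T_xi)
  have th_hor: "th (hor x) = th x" for x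
    by (simp add: hor_def th_simps th_xi)
  define S where "S x y z = wedge_metric th hor x y z + wedge_metric (\<lambda>x. th (\<phi> x)) \<phi> x y z" for x y z
  have S_fun: "S = (\<lambda>x y z. wedge_metric th hor x y z + wedge_metric (\<lambda>x. th (\<phi> x)) \<phi> x y z)"
    unfolding S_def by (rule refl)
  have S_eq: "S x y z = th y * g (hor x) z - th x * g (hor y) z
      + th (\<phi> y) * g (\<phi> x) z - th (\<phi> x) * g (\<phi> y) z" for x y z
    by (simp add: S_def wedge_metric_def)
  have S_torsion: "S \<in> torsion_tensors"
    by (rule torsion_tensorsI) (simp_all add: S_eq th_simps hor_linear phi_linear g_linear algebra_simps)
  have S: "S \<in> W13"
  proof (rule W13I[OF S_torsion])
    show "S \<xi> y z = 0" "S x y \<xi> = 0" for x y z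
      by (simp_all add: S_eq hor_simps th_simps th_xi g_linear g_xi)
    show "S (\<phi> x) (\<phi> y) z = S x y z" for x y z
      by (simp add: S_eq hor_simps th_simps th_hor g_linear)
    show "cyclic_sum S x y z = 0" for x y z
    proof -
      have "g (hor u) v = g (hor v) u" "g (\<phi> u) v = g (\<phi> v) u" for u v
        using g_hor g_phi sym_g by metis+
      from this[of x y] this[of x z] this[of y z] show ?thesis
        by (simp add: cyclic_sum_def S_eq)
    qed
  qed
  have t_S: "t_form S x = t_form T x" for x
  proof -
    have "t_form S x = (\<Sum>a\<in>some_basis ker_eta. g (hor x) (H.dual a) * th a)
        - th x * H.contraction g
        + (\<Sum>a\<in>some_basis ker_eta. g (\<phi> x) (H.dual a) * th (\<phi> a))
        - th (\<phi> x) * H.contraction (\<lambda>x y. g (\<phi> x) y)"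
      by (simp add: t_form_contraction[OF S_torsion] H.contraction_def S_eq hor_H
          sum.distrib sum_subtractf sum_distrib_left mult.commute)
    also have "(\<Sum>a\<in>some_basis ker_eta. g (hor x) (H.dual a) * th a) = th x"
      by (subst H.contract_basis[OF th]) (simp_all add: span_H hor_simps th_hor)
    also have "(\<Sum>a\<in>some_basis ker_eta. g (\<phi> x) (H.dual a) * th (\<phi> a)) = - th x"
      using H.contract_basis[OF linear_compose[OF linear_phi th], of "\<phi> x"]
      by (simp add: span_H hor_simps th_hor th_simps)
    also have "th x - th x * H.contraction g + - th x
        - th (\<phi> x) * H.contraction (\<lambda>x y. g (\<phi> x) y) = - m * th x"
      by (simp add: trace_phi_zero H.contraction_metric m_def)
    also have "- m * th x = t_form T x"
    proof (cases "m = 0")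
      case True
      then have "some_basis ker_eta = {}" using H.finite_basis by (simp add: m_def)
      then have "t_form T x = 0"
        unfolding t_form_contraction[OF T_torsion] H.contraction_def by simp
      then show ?thesis using True by simp
    qed (simp add: th_def)
    finally show ?thesis .
  qed
  have orth: "tensor_inner g S R = 0" if R: "R \<in> T5" for R
  proof -
    have R_torsion: "R \<in> torsion_tensors" and R_xi: "\<And>y z. R \<xi> y z = 0" "\<And>x y. R x y \<xi> = 0"
      and R_phi: "\<And>x y z. R (\<phi> x) (\<phi> y) z = R x y z" and t: "\<And>x. t_form R x = 0"
      using R W13D[of R] unfolding T5_def by blast+
    note linR = torsion_tensors_linear[OF R_torsion]
    have R_xi': "R x \<xi> z = 0" for x z
      using torsion_tensors_antisym[OF R_torsion, of x \<xi> z] R_xi by simp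
    have t_star: "t_star_form R x = 0" for x
      using t_form_phi[OF R_torsion R_xi(1) R_phi, of x] t by simp
    have linP: "linear (\<lambda>x. R w a (P x))" if "linear P" for w a P
      using linear_compose[OF that linR(3)] by (simp add: o_def)
    have "U.contraction (\<lambda>a b. R w a (P b)) = H.contraction (\<lambda>a b. R w a (P b))" if "linear P" for P w
      by (intro contraction_U_H linP that linR R_xi')
    moreover have "H.contraction (\<lambda>a b. R w a (hor b)) = 0" for w
      using t[of w] by (simp add: t_form_contraction[OF R_torsion] H.contraction_def hor_H)
    moreover have "H.contraction (\<lambda>a b. R w a (\<phi> b)) = 0" for w
      using t_star[of w] by (simp add: t_star_form_contraction[OF R_torsion])
    ultimately show ?thesis
      unfolding S_fun
      by (simp add: tensor_inner_add tensor_inner_wedge_metric[OF R_torsion] linear_hor linear_phi)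
  qed
  have "S \<in> T4" using S orth by (simp add: T4_def orth_compl_in_def)
  moreover have "(\<lambda>x y z. T x y z - S x y z) \<in> T5"
  proof -
    have torsion: "(\<lambda>x y z. T x y z - S x y z) \<in> torsion_tensors"
      by (rule torsion_tensors_diff[OF T_torsion S_torsion])
    have "t_form (\<lambda>x y z. T x y z - S x y z) x = 0" for x
      using t_S[of x] by (simp add: t_form_contraction torsion T_torsion S_torsion H.contraction_def sum_subtractf)
    moreover have "(\<lambda>x y z. T x y z - S x y z) \<in> W13"
    proof (rule W13I[OF torsion])
      show "cyclic_sum (\<lambda>x y z. T x y z - S x y z) x y z = 0" for x y z
        using W13D(5)[OF T, of x y z] W13D(5)[OF S, of x y z] by (simp add: cyclic_sum_def)
    qed (simp_all add: W13D(2-4)[OF T] W13D(2-4)[OF S])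
    ultimately show ?thesis by (simp add: T5_def)
  qed
  ultimately show ?thesis by (intro bexI) auto
qed

text \<open>Every element \<open>T\<close> of \<open>\<W>\<^sub>3\<close> has this form, with \<open>b = T(\<xi>,\<cdot>,\<cdot>)\<close>; the classes \<open>\<W>\<^sub>3\<^sub>,\<^sub>k\<close> are thereby
  reduced to symmetry types of bilinear forms on \<open>ker \<eta>\<close>.\<close>

definition eta_wedge :: "('v \<Rightarrow> 'v \<Rightarrow> real) \<Rightarrow> 'v tensor3" where
  "eta_wedge b x y z = \<eta> x * b y z - \<eta> y * b x z"

lemma eta_wedge_W3:
  assumes "bilinear b" "\<And>z. b \<xi> z = 0" "\<And>y. b y \<xi> = 0"
  shows "eta_wedge b \<in> W3" "eta_wedge b \<xi> y z = b y z"
proof -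
  have lin: "linear (\<lambda>y. b y z)" "linear (b y)" for y z
    using assms(1) unfolding bilinear_def by auto
  note b_simps = linear_simps[OF lin(1)] linear_simps[OF lin(2)]
  have hor: "b (hor y) (hor z) = b y z" for y z
    by (simp add: hor_def b_simps assms)
  show "eta_wedge b \<xi> y z = b y z"
    by (simp add: eta_wedge_def assms eta_xi)
  have "eta_wedge b \<in> torsion_tensors"
    unfolding eta_wedge_def
    by (rule torsion_tensorsI) (simp_all add: b_simps eta_linear algebra_simps)
  then show "eta_wedge b \<in> W3"
    by (simp add: W3_def hor_simps eta_wedge_def b_simps hor assms)
qed

lemma W3_eta_wedge:
  assumes "T \<in> W3"
  shows "T = eta_wedge (T \<xi>)" "T \<in> torsion_tensors" "bilinear (T \<xi>)" "T \<xi> \<xi> z = 0" "T \<xi> y \<xi> = 0"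
proof -
  show T: "T \<in> torsion_tensors" using assms by (simp add: W3_def)
  have eq: "T x y z = \<eta> x * T \<xi> (\<phi> (\<phi> y)) (\<phi> (\<phi> z)) - \<eta> y * T \<xi> (\<phi> (\<phi> x)) (\<phi> (\<phi> z))" for x y z
    using assms unfolding W3_def by blast
  have hor: "T \<xi> (\<phi> (\<phi> y)) (\<phi> (\<phi> z)) = T \<xi> y z" for y z
    by (subst (2) eq) (simp add: hor_simps phi_linear torsion_tensors_simps[OF T])
  have "T x y z = eta_wedge (T \<xi>) x y z" for x y z
    unfolding eta_wedge_def using eq[of x y z] by (simp only: hor)
  then show "T = eta_wedge (T \<xi>)" by blast
  show "bilinear (T \<xi>)"
    using torsion_tensors_linear[OF T] by (simp add: bilinear_def)
  show "T \<xi> \<xi> z = 0" "T \<xi> y \<xi> = 0"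
    by (subst eq, simp add: hor_simps phi_linear torsion_tensors_simps[OF T])+
qed

lemma W3_contraction:
  assumes "T \<in> W3"
  shows "t_form T x = \<eta> x * H.contraction (T \<xi>)"
    and "t_star_form T x = \<eta> x * H.contraction (\<lambda>a b. T \<xi> a (\<phi> b))"
proof -
  have "T x a b = \<eta> x * T \<xi> a b" if "a \<in> some_basis ker_eta" for a b
    using fun_cong[OF fun_cong[OF fun_cong[OF W3_eta_wedge(1)[OF assms]]], of x a b] eta_H(1)[OF that]
    by (simp add: eta_wedge_def)
  then show "t_form T x = \<eta> x * H.contraction (T \<xi>)"
    and "t_star_form T x = \<eta> x * H.contraction (\<lambda>a b. T \<xi> a (\<phi> b))"
    unfolding t_form_contraction[OF W3_eta_wedge(2)[OF assms]]
      t_star_form_contraction[OF W3_eta_wedge(2)[OF assms]] H.contraction_def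
    by (simp_all add: sum_distrib_left)
qed

lemma W31I:
  assumes "bilinear b" "\<And>z. b \<xi> z = 0" "\<And>y. b y \<xi> = 0"
    and "\<And>y z. b y z = b z y" "\<And>y z. b (\<phi> y) (\<phi> z) = - b y z"
  shows "eta_wedge b \<in> W31"
  using eta_wedge_W3[OF assms(1-3)] assms(4)[symmetric] assms(5) unfolding W31_def by auto

text \<open>Contracting the factor \<open>\<eta>\<close> inserts \<open>\<xi>\<close> into \<open>T\<close>, and what remains is \<open>t(\<xi>)\<close> or \<open>t\<^sup>*(\<xi>)\<close>.\<close>

lemma tensor_inner_eta_wedge_metric:
  assumes T: "T \<in> T11" and P: "P = hor \<or> P = \<phi>"
  shows "tensor_inner g (eta_wedge (\<lambda>y z. c * g (P y) z)) T = 0"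
proof -
  have W3: "T \<in> W3" and t: "t_form T x = 0" "t_star_form T x = 0" for x
    using T by (simp_all add: T11_def W31_def)
  note T3 = W3_eta_wedge[OF W3]
  note lin = torsion_tensors_linear[OF T3(2)]
  have linP: "linear P" using P linear_hor linear_phi by blast
  have linTP: "linear (\<lambda>x. T w a (P x))" for w a
    using linear_compose[OF linP lin(3)] by (simp add: o_def)
  have "H.contraction (\<lambda>a b. T \<xi> a (P b)) = 0"
    using P
  proof
    assume "P = hor"
    then show ?thesis
      using t(1)[of \<xi>] by (simp add: t_form_contraction[OF T3(2)] H.contraction_def hor_H)
  next
    assume "P = \<phi>"
    then show ?thesis
      using t(2)[of \<xi>] by (simp add: t_star_form_contraction[OF T3(2)])
  qed
  then have zero: "U.contraction (\<lambda>a b. T \<xi> a (P b)) = 0"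
    using contraction_U_H[of "\<lambda>a b. T \<xi> a (P b)"] linTP lin(2) T3(4) by simp
  have "linear (\<lambda>w. U.contraction (\<lambda>a b. T w a (P b)))"
    unfolding U.contraction_def by (intro linear_compose_sum ballI lin)
  then have "(\<Sum>j\<in>some_basis UNIV. g \<xi> j * U.contraction (\<lambda>a b. T (U.dual j) a (P b))) = 0"
    using U.contract_dual[of "\<lambda>w. U.contraction (\<lambda>a b. T w a (P b))" \<xi>] zero by (simp add: span_U)
  moreover have "g \<xi> j = \<eta> j" for j
    using sym_g[of \<xi> j] g_xi by simp
  ultimately have "tensor_inner g (wedge_metric \<eta> P) T = 0"
    by (simp add: tensor_inner_wedge_metric[OF T3(2) linP])
  moreover have "eta_wedge (\<lambda>y z. c * g (P y) z) = (\<lambda>x y z. (- c) * wedge_metric \<eta> P x y z)"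
    by (simp add: fun_eq_iff eta_wedge_def wedge_metric_def algebra_simps)
  ultimately show ?thesis by (simp only: tensor_inner_scale mult_zero_right)
qed

text \<open>In terms of \<open>T(\<xi>,\<cdot>,\<cdot>)\<close> the splitting subtracts multiples of the two \<open>\<phi>\<close>-anti-invariant symmetric
  forms \<open>g(y,z)\<close> and \<open>g(\<phi>y,z)\<close>. On \<open>ker \<eta>\<close>, of dimension \<open>m\<close>, the first has \<open>t = m\<close> and \<open>t\<^sup>* = 0\<close>,
  the second \<open>t = 0\<close> and \<open>t\<^sup>* = -m\<close>, which fixes the coefficients.\<close>

lemma W31_split:
  assumes T: "T \<in> W31"
  shows "\<exists>S\<in>T9. \<exists>S'\<in>T10. \<exists>R\<in>T11. \<forall>x y z. T x y z = S x y z + S' x y z + R x y z"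
proof -
  have W3: "T \<in> W3" and T_sym: "T \<xi> z y = T \<xi> y z"
    and T_phi_minus: "- T \<xi> (\<phi> y) (\<phi> z) = T \<xi> y z" for y z
    using T unfolding W31_def mem_Collect_eq by metis+
  have T_phi: "T \<xi> (\<phi> y) (\<phi> z) = - T \<xi> y z" for y z
    using T_phi_minus[of y z] by linarith
  note T3 = W3_eta_wedge[OF W3]
  define m where "m = real (card (some_basis ker_eta))"
  define c where "c = H.contraction (T \<xi>) / m"
  define d where "d = - H.contraction (\<lambda>a b. T \<xi> a (\<phi> b)) / m"
  have c: "m * c = H.contraction (T \<xi>)" and d: "m * d = - H.contraction (\<lambda>a b. T \<xi> a (\<phi> b))"
  proof -
    have "H.contraction S = 0" if "m = 0" for S
    proof -
      have "some_basis ker_eta = {}" using that H.finite_basis by (simp add: m_def)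
      then show ?thesis unfolding H.contraction_def by simp
    qed
    then show "m * c = H.contraction (T \<xi>)" "m * d = - H.contraction (\<lambda>a b. T \<xi> a (\<phi> b))"
      by (cases "m = 0"; simp add: c_def d_def)+
  qed
  define b where "b y z = c * g (hor y) z" for y z
  define b' where "b' y z = d * g (\<phi> y) z" for y z
  define r where "r y z = T \<xi> y z - b y z - b' y z" for y z
  have bil: "bilinear b" "bilinear b'"
    unfolding bilinear_def b_def b'_def
    by (auto intro!: linearI simp: g_linear hor_linear phi_linear algebra_simps)
  have "bilinear r"
    using bil T3(3) unfolding bilinear_def r_def by (auto intro!: linear_compose_sub)
  note bil = bil this
  have xi: "b \<xi> z = 0" "b z \<xi> = 0" "b' \<xi> z = 0" "b' z \<xi> = 0" "r \<xi> z = 0" "r z \<xi> = 0" for z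
    by (simp_all add: r_def b_def b'_def hor_simps g_linear g_xi T3(4,5))
  have sym: "b y z = b z y" "b' y z = b' z y" "r y z = r z y" for y z
  proof -
    have "g (hor y) z = g (hor z) y" "g (\<phi> y) z = g (\<phi> z) y"
      using g_hor g_phi sym_g by metis+
    then show "b y z = b z y" "b' y z = b' z y" by (simp_all add: b_def b'_def)
    then show "r y z = r z y" by (simp add: r_def T_sym)
  qed
  have phi: "b (\<phi> y) (\<phi> z) = - b y z" "b' (\<phi> y) (\<phi> z) = - b' y z" "r (\<phi> y) (\<phi> z) = - r y z" for y z
  proof -
    have "g (hor u) (\<phi> v) = g (\<phi> u) v" "g (\<phi> u) (\<phi> v) = - g (hor u) v" for u v
      using g_hor[of u "\<phi> v"] g_phi[of u v] g_phi[of "\<phi> u" v] by (simp_all add: hor_simps g_linear)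
    then show "b (\<phi> y) (\<phi> z) = - b y z" "b' (\<phi> y) (\<phi> z) = - b' y z"
      by (simp_all add: b_def b'_def hor_simps g_linear)
    then show "r (\<phi> y) (\<phi> z) = - r y z" by (simp add: r_def T_phi)
  qed
  have W31: "eta_wedge b \<in> W31" "eta_wedge b' \<in> W31" "eta_wedge r \<in> W31"
    by (rule W31I, rule bil, rule xi, rule xi, rule sym, rule phi)+
  have W3': "eta_wedge b \<in> W3" "eta_wedge b' \<in> W3" "eta_wedge r \<in> W3"
    using W31 by (simp_all add: W31_def)
  have at_xi: "eta_wedge b \<xi> = b" "eta_wedge b' \<xi> = b'" "eta_wedge r \<xi> = r"
    by (simp_all add: fun_eq_iff eta_wedge_W3(2) bil xi)
  have trace_b: "H.contraction b = m * c"
    using H.contraction_metric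
    by (simp add: H.contraction_def b_def hor_H m_def sum_distrib_left[symmetric])
  have trace_star_b: "H.contraction (\<lambda>x y. b x (\<phi> y)) = 0"
    using trace_phi_zero
    by (simp add: H.contraction_def b_def hor_H g_phi[symmetric] sum_distrib_left[symmetric])
  have trace_b': "H.contraction b' = 0"
    using trace_phi_zero by (simp add: H.contraction_def b'_def sum_distrib_left[symmetric])
  have trace_star_b': "H.contraction (\<lambda>x y. b' x (\<phi> y)) = - m * d"
    using H.contraction_metric
    by (simp add: H.contraction_def b'_def g_phi hor_simps hor_H g_linear m_def sum_negf
        sum_distrib_left[symmetric])
  have trace_r: "H.contraction r = 0" "H.contraction (\<lambda>x y. r x (\<phi> y)) = 0"
    using trace_b trace_star_b trace_b' trace_star_b' c d
    by (simp_all add: H.contraction_def r_def sum_subtractf)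
  have orth: "tensor_inner g (eta_wedge b) S = 0" "tensor_inner g (eta_wedge b') S = 0" if "S \<in> T11" for S
    using tensor_inner_eta_wedge_metric[OF that, of hor c] tensor_inner_eta_wedge_metric[OF that, of \<phi> d]
    unfolding b_def b'_def by auto
  have "eta_wedge b \<in> T9"
    using orth(1) W31(1) W3_contraction(2)[OF W3'(1)] trace_star_b
    by (simp add: T9_def orth_compl_in_def at_xi)
  moreover have "eta_wedge b' \<in> T10"
    using orth(2) W31(2) W3_contraction(1)[OF W3'(2)] trace_b'
    by (simp add: T10_def orth_compl_in_def at_xi)
  moreover have "eta_wedge r \<in> T11"
    using W31(3) W3_contraction[OF W3'(3)] trace_r by (simp add: T11_def at_xi)
  moreover have "T x y z = eta_wedge b x y z + eta_wedge b' x y z + eta_wedge r x y z" for x y z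
    by (subst T3(1)) (simp add: eta_wedge_def r_def algebra_simps)
  ultimately show ?thesis by (intro bexI) auto
qed

section \<open>Torsion tensors without component in \<open>\<W>\<^sub>1\<^sub>,\<^sub>1\<close>\<close>

text \<open>Decompose each argument into its horizontal part and its \<open>\<xi>\<close>-part. The pieces with two
  arguments \<open>\<xi>\<close> add up to an element of \<open>\<W>\<^sub>4\<^sub>,\<^sub>1\<close>. Those with one argument \<open>\<xi>\<close> split into
  \<open>\<plusminus>1\<close>-eigenparts of the substitution \<open>(\<phi>,\<phi>)\<close> and of the transposition. The
  horizontal piece splits into its \<open>\<phi>\<close>-anti-invariant part in the first two arguments, which lies
  in \<open>\<W>\<^sub>1\<^sub>,\<^sub>1 \<oplus> \<W>\<^sub>1\<^sub>,\<^sub>2\<close> and by hypothesis in \<open>\<W>\<^sub>1\<^sub>,\<^sub>2\<close>, and its \<open>\<phi>\<close>-invariant part \<open>P\<close>. In complex terms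
  \<open>P\<close> is given by \<open>P(a,b,c)\<close> with \<open>a, c\<close> of one type and \<open>b\<close> of the other; \<open>\<W>\<^sub>1\<^sub>,\<^sub>3\<close> is the part
  symmetric in \<open>a, c\<close> and \<open>\<W>\<^sub>1\<^sub>,\<^sub>4\<close> the skew one. The cyclic sum of \<open>P\<close> doubles the skew part,
  and averaging over \<open>(\<phi>,\<phi>)\<close> restores the invariance in the first two arguments.\<close>

lemma torsion_class_decomposition:
  assumes T: "T \<in> torsion_tensors"
    and no_W11_part: "\<And>x y z. T (hor x) (hor y) (hor z) - T (\<phi> x) (\<phi> y) (hor z)
      - T (\<phi> x) (hor y) (\<phi> z) - T (hor x) (\<phi> y) (\<phi> z) = 0"
  shows "T \<in> subspace_sum {3..15} torsion_class"
proof -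
  note T_simps = torsion_tensors_simps[OF T]
  note simps = hor_simps hor_linear phi_linear eta_linear T_simps
  \<comment> \<open>With \<open>T x y z = R x y z - R y x z\<close> as a rewrite rule the antisymmetry of \<open>T\<close> is built in, and
    each identity below becomes a linear one in values of \<open>R\<close>.\<close>
  define R where "R x y z = T x y z / 2" for x y z
  have R_simps: "R (- x) y z = - R x y z" "R x (- y) z = - R x y z" "R x y (- z) = - R x y z"
    "R 0 y z = 0" "R x 0 z = 0" "R x y 0 = 0" for x y z
    by (simp_all add: R_def T_simps)
  have T_R: "T x y z = R x y z - R y x z" for x y z
    using torsion_tensors_antisym[OF T, of x y z] by (simp add: R_def)
  have T_antisym: "T x y z + T y x z = 0" for x y z
    by (simp add: T_R)
  define P where "P x y z = (T (hor x) (hor y) (hor z) + T (\<phi> x) (\<phi> y) (hor z)) / 2" for x y z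
  define S3 where "S3 x y z = (T (hor x) (hor y) (hor z) - T (\<phi> x) (\<phi> y) (hor z)) / 2" for x y z
  define S6 where "S6 x y z = (cyclic_sum P x y z + cyclic_sum P (\<phi> x) (\<phi> y) z) / 4" for x y z
  define S13 where "S13 x y z = P x y z - S6 x y z" for x y z
  define S7 where "S7 x y z = \<eta> z * (T (hor x) (hor y) \<xi> - T (\<phi> x) (\<phi> y) \<xi>) / 2" for x y z
  define S8 where "S8 x y z = \<eta> z * (T (hor x) (hor y) \<xi> + T (\<phi> x) (\<phi> y) \<xi>) / 2" for x y z
  define S15 where "S15 x y z = \<eta> z * (\<eta> y * T x \<xi> \<xi> - \<eta> x * T y \<xi> \<xi>)" for x y z
  \<comment> \<open>The signs \<open>e\<close> and \<open>f\<close> are the eigenvalues under transposition and under \<open>(\<phi>,\<phi>)\<close>.\<close>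
  define B where "B e f y z = (T \<xi> (hor y) (hor z) + e * T \<xi> (hor z) (hor y)
     + f * (T \<xi> (\<phi> y) (\<phi> z) + e * T \<xi> (\<phi> z) (\<phi> y))) / 4" for e f :: real and y z
  have S3_W12: "S3 \<in> W12"
  proof -
    have "S3 \<in> torsion_tensors"
    proof (rule torsion_tensorsI)
      show "S3 x y z = - S3 y x z" for x y z by (simp add: S3_def T_R field_simps)
    qed (simp_all add: S3_def simps algebra_simps add_divide_distrib diff_divide_distrib)
    moreover have "S3 x y z = S3 (\<phi> x) y (\<phi> z)" for x y z
      using no_W11_part[of x y z] by (simp add: S3_def simps field_simps)
    moreover have "S3 \<xi> y z = 0" "S3 x y \<xi> = 0" "S3 x y z = - S3 (\<phi> x) (\<phi> y) z" for x y z
      by (simp_all add: S3_def simps field_simps)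
    ultimately show ?thesis unfolding W12_def by blast
  qed
  have S6_torsion: "S6 \<in> torsion_tensors"
  proof (rule torsion_tensorsI)
    show "S6 x y z = - S6 y x z" for x y z
      by (simp add: S6_def P_def cyclic_sum_def hor_simps hor_linear phi_linear T_R R_simps field_simps)
  qed (simp_all add: S6_def P_def cyclic_sum_def simps algebra_simps add_divide_distrib diff_divide_distrib)
  have P_torsion: "P \<in> torsion_tensors"
  proof (rule torsion_tensorsI)
    show "P x y z = - P y x z" for x y z by (simp add: P_def T_R field_simps)
  qed (simp_all add: P_def simps algebra_simps add_divide_distrib)
  have S6_W14: "S6 \<in> W14"
  proof -
    have "S6 \<xi> y z = 0" "S6 x y \<xi> = 0" "S6 x y z - S6 (\<phi> x) (\<phi> y) z = 0" for x y z
      by (simp_all add: S6_def P_def cyclic_sum_def hor_simps hor_linear phi_linear T_R R_simps field_simps)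
    moreover have "cyclic_sum (\<lambda>u v w. S6 (\<phi> u) v w) x y z = 0" for x y z
      by (simp add: S6_def P_def cyclic_sum_def hor_simps hor_linear phi_linear T_R R_simps field_simps)
    ultimately show ?thesis using S6_torsion unfolding W14_def by blast
  qed
  have S13_W13: "S13 \<in> W13"
  proof (rule W13I)
    show "S13 \<in> torsion_tensors"
      unfolding S13_def by (rule torsion_tensors_diff[OF P_torsion S6_torsion])
    show "S13 \<xi> y z = 0" "S13 x y \<xi> = 0" "S13 (\<phi> x) (\<phi> y) z = S13 x y z"
      "cyclic_sum S13 x y z = 0" for x y z
      by (simp_all add: S13_def S6_def P_def cyclic_sum_def hor_simps hor_linear phi_linear T_R R_simps field_simps)
  qed
  have S7_W21: "S7 \<in> W21"
  proof -
    have "S7 \<in> torsion_tensors"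
    proof (rule torsion_tensorsI)
      show "S7 x y z = - S7 y x z" for x y z by (simp add: S7_def T_R field_simps)
    qed (simp_all add: S7_def simps algebra_simps add_divide_distrib diff_divide_distrib)
    then show ?thesis
      unfolding W21_def by (simp add: S7_def simps field_simps)
  qed
  have S8_W22: "S8 \<in> W22"
  proof -
    have "S8 \<in> torsion_tensors"
    proof (rule torsion_tensorsI)
      show "S8 x y z = - S8 y x z" for x y z by (simp add: S8_def T_R field_simps)
    qed (simp_all add: S8_def simps algebra_simps add_divide_distrib)
    then show ?thesis
      unfolding W22_def by (simp add: S8_def simps field_simps)
  qed
  have S15_W41: "S15 \<in> W41"
  proof -
    have "S15 \<in> torsion_tensors"
      by (rule torsion_tensorsI) (simp_all add: S15_def simps algebra_simps)
    moreover have "T \<xi> \<xi> \<xi> = 0" using T_antisym[of \<xi> \<xi> \<xi>] by simp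
    ultimately show ?thesis
      unfolding W41_def by (simp add: S15_def t_hat_form_def simps)
  qed
  have B_bilinear: "bilinear (B e f)" for e f
    unfolding bilinear_def B_def
    by (auto intro!: linearI simp: simps algebra_simps add_divide_distrib)
  have B_xi: "B e f \<xi> z = 0" "B e f y \<xi> = 0" for e f y z
    by (simp_all add: B_def simps)
  note B_W3 = eta_wedge_W3[OF B_bilinear B_xi]
  have B_classes: "eta_wedge (B 1 (-1)) \<in> W31" "eta_wedge (B (-1) (-1)) \<in> W32"
    "eta_wedge (B 1 1) \<in> W33" "eta_wedge (B (-1) 1) \<in> W34"
    unfolding W31_def W32_def W33_def W34_def
    by (simp_all add: B_W3) (simp_all add: B_def simps field_simps)
  obtain S4 S5 where S45: "S4 \<in> T4" "S5 \<in> T5" "\<And>x y z. S13 x y z = S4 x y z + S5 x y z"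
    using W13_split[OF S13_W13] by blast
  obtain S9 S10 S11 where S911: "S9 \<in> T9" "S10 \<in> T10" "S11 \<in> T11"
    "\<And>x y z. eta_wedge (B 1 (-1)) x y z = S9 x y z + S10 x y z + S11 x y z"
    using W31_split[OF B_classes(1)] by blast
  define S where "S k = (if k = 3 then S3 else if k = 4 then S4 else if k = 5 then S5
    else if k = 6 then S6 else if k = 7 then S7 else if k = 8 then S8 else if k = 9 then S9
    else if k = 10 then S10 else if k = 11 then S11 else if k = 12 then eta_wedge (B (-1) (-1))
    else if k = 13 then eta_wedge (B 1 1) else if k = 14 then eta_wedge (B (-1) 1) else S15)" for k :: nat
  have range: "{3..15} = {3, 4, 5, 6, 7, 8, 9, 10, 11, 12, 13, 14, 15::nat}"
    by (auto; presburger)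
  have classes: "\<forall>k\<in>{3..15}. S k \<in> torsion_class k"
    unfolding range
    using S3_W12 S45 S6_W14 S7_W21 S8_W22 S911 B_classes S15_W41
    by (simp add: S_def torsion_class_def)
  have T_sum: "T x y z = (\<Sum>k\<in>{3..15}. S k x y z)" for x y z
  proof -
    have "(\<Sum>k\<in>{3..15}. S k x y z) = S3 x y z + S13 x y z + S6 x y z + S7 x y z + S8 x y z
      + eta_wedge (B 1 (-1)) x y z + eta_wedge (B (-1) (-1)) x y z + eta_wedge (B 1 1) x y z
      + eta_wedge (B (-1) 1) x y z + S15 x y z"
      unfolding range by (simp add: S_def S45(3) S911(4))
    also have "S3 x y z + S13 x y z + S6 x y z = T (hor x) (hor y) (hor z)"
      by (simp add: S13_def S3_def P_def field_simps)
    also have "T (hor x) (hor y) (hor z) + S7 x y z + S8 x y z =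
        T (hor x) (hor y) (hor z) + \<eta> z * T (hor x) (hor y) \<xi>"
      by (simp add: S7_def S8_def field_simps)
    also have "\<dots> + eta_wedge (B 1 (-1)) x y z + eta_wedge (B (-1) (-1)) x y z + eta_wedge (B 1 1) x y z
        + eta_wedge (B (-1) 1) x y z = \<dots> + (\<eta> x * T \<xi> (hor y) (hor z) - \<eta> y * T \<xi> (hor x) (hor z))"
      by (simp add: eta_wedge_def B_def field_simps)
    also have "\<dots> + S15 x y z = T x y z"
      using T_antisym[of y \<xi> z] T_antisym[of x \<xi> z] T_antisym[of x \<xi> \<xi>] T_antisym[of y \<xi> \<xi>]
        T_antisym[of \<xi> \<xi> z] T_antisym[of \<xi> \<xi> \<xi>]
      unfolding S15_def hor_def T_simps by algebra
    finally show ?thesis by simp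
  qed
  then have "T = (\<lambda>x y z. \<Sum>k\<in>{3..15}. S k x y z)" by (simp only: fun_eq_iff) blast
  then show ?thesis using classes unfolding subspace_sum_def by blast
qed

end

section \<open>Calculus of smooth maps\<close>

lemma Ck_on_cong:
  assumes "open S" "\<And>x. x \<in> S \<Longrightarrow> f x = g x" "Ck_on k S f"
  shows "Ck_on k S g"
  using assms(2,3)
proof (induction k arbitrary: f g)
  case 0
  then show ?case using continuous_on_cong[of S S f g] by simp
next
  case (Suc k)
  have diff: "f differentiable at x" if "x \<in> S" for x using Suc.prems that by simp
  have "g differentiable at x" if x: "x \<in> S" for x
  proof -
    obtain f' where "(f has_derivative f') (at x)"
      using diff[OF x] unfolding differentiable_def by blast
    from has_derivative_transform_within_open[OF this assms(1) x Suc.prems(1)]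
    show ?thesis by (rule differentiableI)
  qed
  moreover have "Ck_on k S (\<lambda>x. frechet_derivative g (at x) v)" for v
  proof (rule Suc.IH[of "\<lambda>x. frechet_derivative f (at x) v"])
    show "frechet_derivative f (at x) v = frechet_derivative g (at x) v" if "x \<in> S" for x
      using frechet_derivative_transform_within_open[OF diff assms(1) _ Suc.prems(1)] that by simp
    show "Ck_on k S (\<lambda>x. frechet_derivative f (at x) v)" using Suc.prems by simp
  qed
  ultimately show ?case by simp
qed

lemma Ck_on_subset: "Ck_on k S f \<Longrightarrow> R \<subseteq> S \<Longrightarrow> Ck_on k R f"
  by (induction k arbitrary: f) (auto intro: continuous_on_subset)

lemma Ck_on_SucD: "Ck_on (Suc k) S f \<Longrightarrow> Ck_on k S f"
proof (induction k arbitrary: f)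
  case 0
  then show ?case
    by (auto intro!: continuous_at_imp_continuous_on differentiable_imp_continuous_within)
next
  case (Suc k)
  then show ?case by (metis Ck_on.simps(2))
qed

lemma Ck_on_SucI:
  assumes "open S" "\<And>x. x \<in> S \<Longrightarrow> (f has_derivative f' x) (at x)" "\<And>v. Ck_on k S (\<lambda>x. f' x v)"
  shows "Ck_on (Suc k) S f"
proof -
  have "f differentiable at x" if "x \<in> S" for x
    using assms(2)[OF that] by (rule differentiableI)
  moreover have "Ck_on k S (\<lambda>x. frechet_derivative f (at x) v)" for v
    using frechet_derivative_at[OF assms(2)] by (intro Ck_on_cong[OF assms(1) _ assms(3)]) simp
  ultimately show ?thesis by simp
qed

lemma Ck_on_SucE:
  assumes "Ck_on (Suc k) S f"
  shows "x \<in> S \<Longrightarrow> (f has_derivative frechet_derivative f (at x)) (at x)"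
    "Ck_on k S (\<lambda>x. frechet_derivative f (at x) v)"
  using assms by (auto simp: frechet_derivative_works)

lemma Ck_on_const: "open S \<Longrightarrow> Ck_on k S (\<lambda>x. c)"
proof (induction k arbitrary: c)
  case (Suc k)
  then show ?case by (intro Ck_on_SucI[where f'="\<lambda>x v. 0"]) auto
qed simp

lemma Ck_on_bounded_linear:
  assumes "bounded_linear L" "open S" "Ck_on k S f"
  shows "Ck_on k S (\<lambda>x. L (f x))"
  using assms(3)
proof (induction k arbitrary: f)
  case 0
  then show ?case using bounded_linear.continuous_on[OF assms(1)] by simp
next
  case (Suc k)
  show ?case
    by (rule Ck_on_SucI[OF assms(2) bounded_linear.has_derivative[OF assms(1) Ck_on_SucE(1)[OF Suc.prems]]])
       (auto intro: Suc.IH Ck_on_SucE(2)[OF Suc.prems])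
qed

lemma Ck_on_add:
  assumes "open S" "Ck_on k S f" "Ck_on k S g"
  shows "Ck_on k S (\<lambda>x. f x + g x)"
  using assms(2,3)
proof (induction k arbitrary: f g)
  case (Suc k)
  show ?case
    by (rule Ck_on_SucI[OF assms(1) has_derivative_add[OF Suc.prems[THEN Ck_on_SucE(1)]]])
       (auto intro: Suc.IH Ck_on_SucE(2)[OF Suc.prems(1)] Ck_on_SucE(2)[OF Suc.prems(2)])
qed (simp add: continuous_on_add)

lemma Ck_on_scaleR:
  fixes f :: "'a::real_normed_vector \<Rightarrow> real"
  assumes "open S" "Ck_on k S f" "Ck_on k S g"
  shows "Ck_on k S (\<lambda>x. f x *\<^sub>R g x)"
  using assms(2,3)
proof (induction k arbitrary: f g)
  case (Suc k)
  show ?case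
    by (rule Ck_on_SucI[OF assms(1) has_derivative_scaleR[OF Suc.prems[THEN Ck_on_SucE(1)]]])
       (auto intro!: Ck_on_add assms(1) Suc.IH Ck_on_SucD[OF Suc.prems(1)] Ck_on_SucD[OF Suc.prems(2)]
         Ck_on_SucE(2)[OF Suc.prems(1)] Ck_on_SucE(2)[OF Suc.prems(2)])
qed (simp add: continuous_on_scaleR)

lemma Ck_on_sum:
  assumes "open S" "\<And>i. i \<in> I \<Longrightarrow> Ck_on k S (f i)"
  shows "Ck_on k S (\<lambda>x. \<Sum>i\<in>I. f i x)"
  using assms(2) by (induction I rule: infinite_finite_induct) (auto intro!: Ck_on_add Ck_on_const assms(1))

text \<open>By the chain rule the derivative of \<open>f \<circ> g\<close> in direction \<open>v\<close> is a combination of the maps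
  \<open>D\<^sub>b f \<circ> g\<close>, for basis vectors \<open>b\<close>, with the components of \<open>D\<^sub>v g\<close> as coefficients; the induction
  hypothesis applies to these maps, which is why \<open>f\<close> is kept arbitrary.\<close>

lemma Ck_on_compose:
  fixes g :: "'a::real_normed_vector \<Rightarrow> 'b::euclidean_space"
  assumes "open S" "open R" "g ` S \<subseteq> R" "Ck_on k R f" "Ck_on k S g"
  shows "Ck_on k S (\<lambda>x. f (g x))"
  using assms(4,5)
proof (induction k arbitrary: f)
  case 0
  then show ?case using continuous_on_compose2[of R f S g] assms(3) by simp
next
  case (Suc k)
  note f = Ck_on_SucE[OF Suc.prems(1)] and g = Ck_on_SucE[OF Suc.prems(2)]
  show ?case
  proof (rule Ck_on_SucI[OF assms(1)])
    fix x assume x: "x \<in> S"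
    show "((\<lambda>x. f (g x)) has_derivative
        (\<lambda>v. \<Sum>b\<in>Basis. (frechet_derivative g (at x) v \<bullet> b) *\<^sub>R frechet_derivative f (at (g x)) b)) (at x)"
    proof -
      have f': "(f has_derivative frechet_derivative f (at (g x))) (at (g x))"
        using x assms(3) f(1) by blast
      then have lin: "linear (frechet_derivative f (at (g x)))"
        by (rule has_derivative_linear)
      have "(\<Sum>b\<in>Basis. (w \<bullet> b) *\<^sub>R frechet_derivative f (at (g x)) b) = frechet_derivative f (at (g x)) w" for w
        by (simp add: linear_sum[OF lin, symmetric] linear_scale[OF lin, symmetric] euclidean_representation)
      then show ?thesis
        using has_derivative_compose[OF g(1)[OF x] f'] by simp
    qed
  next
    fix v
    have "Ck_on k S (\<lambda>x. frechet_derivative f (at (g x)) b)" for b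
      by (rule Suc.IH[OF f(2) Ck_on_SucD[OF Suc.prems(2)]])
    then show "Ck_on k S (\<lambda>x. \<Sum>b\<in>Basis. (frechet_derivative g (at x) v \<bullet> b) *\<^sub>R frechet_derivative f (at (g x)) b)"
      by (intro Ck_on_sum Ck_on_scaleR Ck_on_bounded_linear[OF bounded_linear_inner_left] assms(1) g(2))
  qed
qed

lemma smooth_on_cong: "open S \<Longrightarrow> (\<And>x. x \<in> S \<Longrightarrow> f x = g x) \<Longrightarrow> smooth_on S f \<Longrightarrow> smooth_on S g"
  unfolding smooth_on_def using Ck_on_cong by blast

lemma smooth_on_subset: "smooth_on S f \<Longrightarrow> R \<subseteq> S \<Longrightarrow> smooth_on R f"
  unfolding smooth_on_def using Ck_on_subset by blast

lemma smooth_on_add: "open S \<Longrightarrow> smooth_on S f \<Longrightarrow> smooth_on S g \<Longrightarrow> smooth_on S (\<lambda>x. f x + g x)"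
  unfolding smooth_on_def using Ck_on_add by blast

lemma smooth_on_const: "open S \<Longrightarrow> smooth_on S (\<lambda>x. c)"
  unfolding smooth_on_def using Ck_on_const by blast

lemma smooth_on_scaleR:
  fixes f :: "'a::real_normed_vector \<Rightarrow> real"
  shows "open S \<Longrightarrow> smooth_on S f \<Longrightarrow> smooth_on S g \<Longrightarrow> smooth_on S (\<lambda>x. f x *\<^sub>R g x)"
  unfolding smooth_on_def using Ck_on_scaleR by blast

lemma smooth_on_inner: "open S \<Longrightarrow> smooth_on S f \<Longrightarrow> smooth_on S (\<lambda>x. f x \<bullet> b)"
  unfolding smooth_on_def using Ck_on_bounded_linear[OF bounded_linear_inner_left] by blast

lemma smooth_on_compose:
  fixes g :: "'a::real_normed_vector \<Rightarrow> 'b::euclidean_space"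
  shows "open S \<Longrightarrow> open R \<Longrightarrow> g ` S \<subseteq> R \<Longrightarrow> smooth_on R f \<Longrightarrow> smooth_on S g \<Longrightarrow> smooth_on S (\<lambda>x. f (g x))"
  unfolding smooth_on_def using Ck_on_compose by blast

lemma smooth_on_frechet_derivative: "smooth_on S f \<Longrightarrow> smooth_on S (\<lambda>x. frechet_derivative f (at x) v)"
  unfolding smooth_on_def using Ck_on_SucE(2) by blast

lemma smooth_on_differentiable: "smooth_on S f \<Longrightarrow> x \<in> S \<Longrightarrow> f differentiable at x"
  unfolding smooth_on_def by (metis Ck_on.simps(2))

section \<open>Coordinate fields and linear connections\<close>

definition transition_deriv ::
  "('m, 'e::euclidean_space) chart \<Rightarrow> ('m, 'e) chart \<Rightarrow> 'm \<Rightarrow> 'e \<Rightarrow> 'e" where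
  "transition_deriv c d q = frechet_derivative (snd d \<circ> chart_inv c) (at (snd c q))"

lemma components_transition_deriv: "components A c q = transition_deriv (chart_at A q) c q"
  by (simp add: components_def transition_deriv_def fun_eq_iff)

context smooth_manifold
begin

lemma chart_at: "chart_at A p \<in> A" "p \<in> fst (chart_at A p)"
proof -
  have "\<exists>c. c \<in> A \<and> p \<in> fst c" using covering by blast
  then have "chart_at A p \<in> A \<and> p \<in> fst (chart_at A p)"
    unfolding chart_at_def by (rule someI_ex)
  then show "chart_at A p \<in> A" "p \<in> fst (chart_at A p)" by auto
qed

lemma chart_inv_chart: "c \<in> A \<Longrightarrow> q \<in> fst c \<Longrightarrow> chart_inv c (snd c q) = q"
  using charts[of c] unfolding is_chart_def by (auto intro: homeomorphism_apply1)

lemma open_chart: "c \<in> A \<Longrightarrow> open (fst c)"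
  using charts[of c] by (simp add: is_chart_def)

lemma open_chart_image:
  assumes "c \<in> A" "open U"
  shows "open (snd c ` (fst c \<inter> U))"
proof -
  have hom: "homeomorphism (fst c) (snd c ` fst c) (snd c) (chart_inv c)" and op: "open (snd c ` fst c)"
    using charts[OF assms(1)] by (auto simp: is_chart_def)
  have "openin (top_of_set (snd c ` fst c)) (snd c ` (fst c \<inter> U))"
    by (rule homeomorphism_imp_open_map[OF hom]) (rule openin_open_Int[OF assms(2)])
  then show ?thesis using op by (rule openin_open_trans)
qed

lemma transition_deriv_works:
  assumes "c \<in> A" "d \<in> A" "q \<in> fst c" "q \<in> fst d"
  shows "(snd d \<circ> chart_inv c has_derivative transition_deriv c d q) (at (snd c q))"
  unfolding transition_deriv_def frechet_derivative_works[symmetric]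
  using assms by (intro smooth_on_differentiable[OF compatible]) auto

lemma transition_deriv_linear:
  assumes "c \<in> A" "d \<in> A" "q \<in> fst c" "q \<in> fst d"
  shows "linear (transition_deriv c d q)"
  using transition_deriv_works[OF assms] by (rule has_derivative_linear)

lemma transition_deriv_chain:
  assumes c: "c \<in> A" "q \<in> fst c" and d: "d \<in> A" "q \<in> fst d" and e: "e \<in> A" "q \<in> fst e"
  shows "transition_deriv d e q (transition_deriv c d q v) = transition_deriv c e q v"
proof -
  let ?S = "snd c ` (fst c \<inter> fst d)"
  have "((snd e \<circ> chart_inv d) \<circ> (snd d \<circ> chart_inv c) has_derivative transition_deriv d e q \<circ> transition_deriv c d q)
      (at (snd c q))"
    using assms by (intro diff_chain_at transition_deriv_works) (simp_all add: chart_inv_chart transition_deriv_works)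
  moreover have "open ?S" using c d by (intro open_chart_image open_chart)
  ultimately have "(snd e \<circ> chart_inv c has_derivative transition_deriv d e q \<circ> transition_deriv c d q) (at (snd c q))"
    using c d by (elim has_derivative_transform_within_open[of _ _ _ _ ?S]) (auto simp: chart_inv_chart)
  then have "transition_deriv d e q \<circ> transition_deriv c d q = transition_deriv c e q"
    using transition_deriv_works assms has_derivative_unique by blast
  then show ?thesis by (metis comp_apply)
qed

lemma transition_deriv_self:
  assumes "c \<in> A" "q \<in> fst c"
  shows "transition_deriv c c q v = v"
proof -
  have "((\<lambda>x. x) has_derivative (\<lambda>x. x)) (at (snd c q))" by (rule has_derivative_ident)
  moreover have "open (snd c ` (fst c \<inter> UNIV))" using assms by (intro open_chart_image) auto
  ultimately have "(snd c \<circ> chart_inv c has_derivative (\<lambda>x. x)) (at (snd c q))"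
    using assms by (elim has_derivative_transform_within_open) (auto simp: chart_inv_chart)
  then have "transition_deriv c c q = (\<lambda>x. x)"
    using transition_deriv_works assms has_derivative_unique by blast
  then show ?thesis by simp
qed

lemma components_linear: "c \<in> A \<Longrightarrow> q \<in> fst c \<Longrightarrow> linear (components A c q)"
  unfolding components_transition_deriv by (intro transition_deriv_linear chart_at)

lemma field_rep_chart: "c \<in> A \<Longrightarrow> q \<in> fst c \<Longrightarrow> field_rep A c X (snd c q) = components A c q (X q)"
  by (simp add: field_rep_def chart_inv_chart)

lemma smooth_field_on_subset: "smooth_field_on A U X \<Longrightarrow> R \<subseteq> U \<Longrightarrow> smooth_field_on A R X"
  unfolding smooth_field_on_def by (meson Int_mono image_mono order_refl smooth_on_subset)

text \<open>The representative \<open>r c\<close> need only be correct on the image of the chart, so that it can be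
  chosen as a formula that is visibly smooth there.\<close>

lemma smooth_field_onI:
  assumes "open U" "\<And>c. c \<in> A \<Longrightarrow> smooth_on (snd c ` (fst c \<inter> U)) (r c)"
    and "\<And>c q. c \<in> A \<Longrightarrow> q \<in> fst c \<Longrightarrow> q \<in> U \<Longrightarrow> r c (snd c q) = components A c q (X q)"
  shows "smooth_field_on A U X"
  unfolding smooth_field_on_def
proof
  fix c assume c: "c \<in> A"
  show "smooth_on (snd c ` (fst c \<inter> U)) (field_rep A c X)"
    by (rule smooth_on_cong[OF open_chart_image[OF c assms(1)] _ assms(2)[OF c]])
       (auto simp: field_rep_chart c assms(3))
qed

lemma smooth_field_on_add:
  assumes "open U" "smooth_field_on A U X" "smooth_field_on A U Y"
  shows "smooth_field_on A U (\<lambda>q. X q + Y q)"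
proof (rule smooth_field_onI[OF assms(1)])
  show "smooth_on (snd c ` (fst c \<inter> U)) (\<lambda>y. field_rep A c X y + field_rep A c Y y)" if "c \<in> A" for c
    using assms that unfolding smooth_field_on_def by (intro smooth_on_add open_chart_image) auto
qed (simp add: field_rep_chart linear_add[OF components_linear])

lemma smooth_field_on_scaleR:
  assumes "open U" "smooth_fun_on A U f" "smooth_field_on A U Y"
  shows "smooth_field_on A U (\<lambda>q. f q *\<^sub>R Y q)"
proof (rule smooth_field_onI[OF assms(1)])
  show "smooth_on (snd c ` (fst c \<inter> U)) (\<lambda>y. (f \<circ> chart_inv c) y *\<^sub>R field_rep A c Y y)" if "c \<in> A" for c
    using assms that unfolding smooth_field_on_def smooth_fun_on_def
    by (intro smooth_on_scaleR open_chart_image) blast+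
qed (simp add: field_rep_chart linear_scale[OF components_linear] chart_inv_chart)

lemma smooth_field_on_zero: "open U \<Longrightarrow> smooth_field_on A U (\<lambda>q. 0)"
  by (rule smooth_field_onI[where r="\<lambda>c y. 0"])
     (simp_all add: smooth_on_const open_chart_image linear_0[OF components_linear])

lemma smooth_field_on_sum:
  assumes "open U" "\<And>i. i \<in> I \<Longrightarrow> smooth_field_on A U (Y i)"
  shows "smooth_field_on A U (\<lambda>q. \<Sum>i\<in>I. Y i q)"
  using assms(2)
  by (induction I rule: infinite_finite_induct) (auto intro!: smooth_field_on_add smooth_field_on_zero assms(1))

text \<open>The vector field with constant components \<open>v\<close> in the chart \<open>c\<close>. Tangent vectors at \<open>q\<close> are
  represented in the chart chosen for \<open>q\<close>, whence the derivative of the transition map.\<close>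

definition coordinate_field :: "('m, 'e) chart \<Rightarrow> 'e \<Rightarrow> 'm \<Rightarrow> 'e" where
  "coordinate_field c v q = transition_deriv c (chart_at A q) q v"

lemma coordinate_field_smooth:
  assumes c: "c \<in> A"
  shows "smooth_field_on A (fst c) (coordinate_field c v)"
proof (rule smooth_field_onI[OF open_chart[OF c]])
  fix d assume d: "d \<in> A"
  show "smooth_on (snd d ` (fst d \<inter> fst c))
      (\<lambda>y. frechet_derivative (snd d \<circ> chart_inv c) (at ((snd c \<circ> chart_inv d) y)) v)"
  proof (rule smooth_on_compose[where g="snd c \<circ> chart_inv d" and R="snd c ` (fst c \<inter> fst d)"
        and f="\<lambda>x. frechet_derivative (snd d \<circ> chart_inv c) (at x) v"])
    show "open (snd d ` (fst d \<inter> fst c))"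
      by (intro open_chart_image open_chart c d)
    show "open (snd c ` (fst c \<inter> fst d))"
      by (intro open_chart_image open_chart c d)
    show "smooth_on (snd c ` (fst c \<inter> fst d)) (\<lambda>x. frechet_derivative (snd d \<circ> chart_inv c) (at x) v)"
      by (intro smooth_on_frechet_derivative compatible c d)
    show "smooth_on (snd d ` (fst d \<inter> fst c)) (snd c \<circ> chart_inv d)"
      by (intro compatible c d)
    show "(snd c \<circ> chart_inv d) ` snd d ` (fst d \<inter> fst c) \<subseteq> snd c ` (fst c \<inter> fst d)"
      using d by (auto simp: chart_inv_chart)
  qed
  fix q assume q: "q \<in> fst d" "q \<in> fst c"
  show "frechet_derivative (snd d \<circ> chart_inv c) (at ((snd c \<circ> chart_inv d) (snd d q))) v =
      components A d q (coordinate_field c v q)"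
    using c d q chart_at
    by (simp add: components_transition_deriv coordinate_field_def transition_deriv_chain chart_inv_chart)
       (simp add: transition_deriv_def)
qed

lemma coordinate_field_at: "coordinate_field (chart_at A p) v p = v"
  by (simp add: coordinate_field_def transition_deriv_self chart_at)

lemma field_in_coordinates:
  assumes "c \<in> A" "q \<in> fst c"
  shows "(\<Sum>b\<in>Basis. (components A c q v \<bullet> b) *\<^sub>R coordinate_field c b q) = v"
proof -
  have lin: "linear (transition_deriv c (chart_at A q) q)"
    using assms by (intro transition_deriv_linear chart_at)
  have "(\<Sum>b\<in>Basis. (components A c q v \<bullet> b) *\<^sub>R coordinate_field c b q) =
      transition_deriv c (chart_at A q) q (components A c q v)"
    by (simp add: coordinate_field_def linear_sum[OF lin, symmetric] linear_scale[OF lin, symmetric]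
        euclidean_representation)
  then show ?thesis
    using assms by (simp add: components_transition_deriv transition_deriv_chain transition_deriv_self chart_at)
qed

lemma smooth_component:
  assumes c: "c \<in> A" and "open U" "smooth_field_on A U Y"
  shows "smooth_fun_on A (U \<inter> fst c) (\<lambda>q. components A c q (Y q) \<bullet> b)"
  unfolding smooth_fun_on_def
proof
  fix d assume d: "d \<in> A"
  let ?S = "snd d ` (fst d \<inter> (U \<inter> fst c))"
  have op: "open ?S" using c d assms(2) by (intro open_chart_image open_Int open_chart)
  have "smooth_on ?S (\<lambda>y. field_rep A c Y ((snd c \<circ> chart_inv d) y))"
  proof (rule smooth_on_compose[OF op open_chart_image[OF c assms(2)],
        where g="snd c \<circ> chart_inv d" and f="field_rep A c Y"])
    show "(snd c \<circ> chart_inv d) ` ?S \<subseteq> snd c ` (fst c \<inter> U)"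
      using d by (auto simp: chart_inv_chart)
    show "smooth_on (snd c ` (fst c \<inter> U)) (field_rep A c Y)"
      using assms by (simp add: smooth_field_on_def)
    show "smooth_on ?S (snd c \<circ> chart_inv d)"
      by (rule smooth_on_subset[OF compatible[OF d c]]) auto
  qed
  then have "smooth_on ?S (\<lambda>y. field_rep A c Y ((snd c \<circ> chart_inv d) y) \<bullet> b)"
    using op by (intro smooth_on_inner)
  then show "smooth_on ?S ((\<lambda>q. components A c q (Y q) \<bullet> b) \<circ> chart_inv d)"
    by (rule smooth_on_cong[OF op, rotated]) (auto simp: chart_inv_chart c d field_rep_chart)
qed

context
  fixes D :: "('m, 'e) connection" and U :: "'m set" and Y :: "'m \<Rightarrow> 'e" and p :: 'm
  assumes D: "linear_connection A D" and U: "open U" "p \<in> U" and Y: "smooth_field_on A U Y"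
begin

lemmas connection_rules =
  D[unfolded linear_connection_def, THEN spec, THEN spec, THEN mp, OF U(1), THEN mp, OF Y]

lemma connection_linear: "linear (\<lambda>v. D p v Y)"
  by (rule bspec[OF conjunct1[OF connection_rules] U(2)])

lemma connection_add: "smooth_field_on A U Z \<Longrightarrow> D p v (\<lambda>q. Y q + Z q) = D p v Y + D p v Z"
  using conjunct1[OF conjunct2[OF connection_rules]] U(2) by simp

lemma connection_scaleR:
  "smooth_fun_on A U f \<Longrightarrow> D p v (\<lambda>q. f q *\<^sub>R Y q) = dir_deriv A p v f *\<^sub>R Y p + f p *\<^sub>R D p v Y"
  using conjunct1[OF conjunct2[OF conjunct2[OF connection_rules]]] U(2) by simp

lemma connection_local: "(\<And>q. q \<in> U \<Longrightarrow> Z q = Y q) \<Longrightarrow> D p v Z = D p v Y"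
  using conjunct1[OF conjunct2[OF conjunct2[OF conjunct2[OF connection_rules]]]] U(2) by blast

end

lemma connection_zero:
  assumes "linear_connection A D" shows "D p v (\<lambda>q. 0) = 0"
  using connection_add[OF assms open_UNIV UNIV_I smooth_field_on_zero smooth_field_on_zero, of p v] by simp

lemma connection_linear_combination:
  assumes D: "linear_connection A D" and "open U" "p \<in> U" "finite I"
    and "\<And>i. i \<in> I \<Longrightarrow> smooth_fun_on A U (f i)" "\<And>i. i \<in> I \<Longrightarrow> smooth_field_on A U (Y i)"
  shows "D p v (\<lambda>q. \<Sum>i\<in>I. f i q *\<^sub>R Y i q) =
    (\<Sum>i\<in>I. dir_deriv A p v (f i) *\<^sub>R Y i p + f i p *\<^sub>R D p v (Y i))"
  using assms(4-6)
proof (induction I)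
  case (insert i I)
  then have "smooth_field_on A U (\<lambda>q. f i q *\<^sub>R Y i q)" "smooth_field_on A U (\<lambda>q. \<Sum>i\<in>I. f i q *\<^sub>R Y i q)"
    using assms(2) by (auto intro!: smooth_field_on_sum smooth_field_on_scaleR)
  from connection_add[OF D assms(2,3) this] show ?case
    using insert by (simp add: connection_scaleR[OF D assms(2,3)])
qed (simp add: connection_zero[OF D])

end

section \<open>The torsion of the \<open>\<phi>\<close>B-connection\<close>

text \<open>The algebra at one point, with \<open>N x y\<close> for \<open>(\<nabla>\<^sub>x\<phi>)y\<close>, \<open>a x y\<close> for \<open>(\<nabla>\<^sub>x\<eta>)y\<close> and \<open>K x\<close> for \<open>\<nabla>\<^sub>x\<xi>\<close>.
  The hypothesis \<open>N_phi\<close> is the derivative of \<open>\<phi>\<^sup>2 = -Id + \<eta>\<otimes>\<xi>\<close>. Through it the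
  term with \<open>a\<close> inherits its bilinearity from \<open>N\<close> and \<open>K\<close>.\<close>

lemma (in almost_contact_B_metric_space) phiB_torsion_class:
  assumes N: "bilinear N" and K: "linear K"
    and N_phi: "\<And>x y. N x (\<phi> y) + \<phi> (N x y) = a x y *\<^sub>R \<xi> + \<eta> y *\<^sub>R K x"
    and Q: "\<And>x y. Q x y = (1/2) *\<^sub>R (N x (\<phi> y) + a x y *\<^sub>R \<xi>) - \<eta> y *\<^sub>R K x"
  shows "(\<lambda>x y z. g (Q x y - Q y x) z) \<in> subspace_sum {3..15} torsion_class"
proof (rule torsion_class_decomposition)
  have N_simps: "N (x + x') y = N x y + N x' y" "N x (y + y') = N x y + N x y'"
    "N (r *\<^sub>R x) y = r *\<^sub>R N x y" "N x (r *\<^sub>R y) = r *\<^sub>R N x y" "N x (- y) = - N x y" for x x' y y' r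
    using N by (simp_all add: bilinear_ladd bilinear_radd bilinear_lmul bilinear_rmul bilinear_rneg)
  note K_simps = linear_simps[OF K]
  have a: "a x y *\<^sub>R \<xi> = N x (\<phi> y) + \<phi> (N x y) - \<eta> y *\<^sub>R K x" for x y
    by (simp add: N_phi)
  have Q': "Q x y = N x (\<phi> y) + (1/2) *\<^sub>R \<phi> (N x y) - (3/2) *\<^sub>R \<eta> y *\<^sub>R K x" for x y
  proof -
    have "(1/2) *\<^sub>R (u + (u + v - w)) - w = u + (1/2) *\<^sub>R v - (3/2) *\<^sub>R w" for u v w :: 'v
      by (rule euclidean_eqI) (simp add: inner_simps field_simps)
    then show ?thesis using a Q by simp
  qed
  show "(\<lambda>x y z. g (Q x y - Q y x) z) \<in> torsion_tensors"
  proof (rule torsion_tensorsI)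
    show "g (Q x y - Q y x) z = - g (Q y x - Q x y) z" for x y z
      by (simp add: g_linear)
  qed (simp_all add: Q' N_simps K_simps phi_linear eta_linear g_linear algebra_simps)
  define b where "b x y z = g (N x (\<phi> y)) z / 2" for x y z
  have g_Q: "g (Q x y) z = b x y z" if "\<eta> y = 0" "\<eta> z = 0" for x y z
    using that sym_g[of \<xi> z] by (simp add: Q b_def g_linear g_xi)
  have b_phi: "b x (\<phi> y) z = - b x y (\<phi> z)" if y: "\<eta> y = 0" and z: "\<eta> z = 0" for x y z
  proof -
    have "N x (\<phi> y) = a x y *\<^sub>R \<xi> - \<phi> (N x y)"
      using N_phi[of x y] y by (simp add: eq_diff_eq)
    then have "g (N x (\<phi> y)) (\<phi> z) = g (N x y) z"
      using sym_g[of \<xi> "\<phi> z"] z by (simp add: g_linear g_xi eta_phi g_phi_phi)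
    moreover have "N x (\<phi> (\<phi> y)) = - N x y"
      using y by (simp add: phi_phi N_simps)
    ultimately show ?thesis by (simp add: b_def g_linear)
  qed
  fix x y z
  have "b u (\<phi> v) (hor w) = - b u (hor v) (\<phi> w)" "b u (\<phi> v) (\<phi> w) = b u (hor v) (hor w)" for u v w
    using b_phi[of "hor v" "hor w" u] b_phi[of "hor v" "\<phi> w" u] by (simp_all add: hor_simps b_def g_linear)
  then show "g (Q (hor x) (hor y) - Q (hor y) (hor x)) (hor z) - g (Q (\<phi> x) (\<phi> y) - Q (\<phi> y) (\<phi> x)) (hor z)
      - g (Q (\<phi> x) (hor y) - Q (hor y) (\<phi> x)) (\<phi> z) - g (Q (hor x) (\<phi> y) - Q (\<phi> y) (hor x)) (\<phi> z) = 0"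
    by (simp add: g_linear g_Q hor_simps)
qed

context almost_contact_B_metric_manifold
begin

lemmas phi_linear_at = linear_simps[OF almost_contact_B_metric_space.linear_phi[OF pointwise]]

text \<open>Near \<open>p\<close> write \<open>Y = \<Sum> f\<^sub>b E\<^sub>b\<close> with coordinate fields \<open>E\<^sub>b\<close>. By the Leibniz rule both \<open>D(\<phi>Y)\<close> and
  \<open>\<phi>(DY)\<close> contain the term \<open>\<Sum> df\<^sub>b(v) \<phi>E\<^sub>b\<close>, which cancels.\<close>

lemma cov_deriv_phi_tensorial:
  assumes D: "linear_connection A D" and U: "open U" "p \<in> U" and Y: "smooth_field_on A U Y"
  shows "cov_deriv_endo D \<phi> p v Y =
    (\<Sum>b\<in>Basis. (Y p \<bullet> b) *\<^sub>R cov_deriv_endo D \<phi> p v (coordinate_field (chart_at A p) b))"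
proof -
  let ?c = "chart_at A p"
  define E where "E b = coordinate_field ?c b" for b
  define f where "f b q = components A ?c q (Y q) \<bullet> b" for b q
  have c: "?c \<in> A" "p \<in> fst ?c" by (rule chart_at)+
  have U': "open (U \<inter> fst ?c)" "p \<in> U \<inter> fst ?c"
    using U c by (simp_all add: open_Int open_chart)
  have E: "smooth_field_on A (U \<inter> fst ?c) (E b)" for b
    unfolding E_def by (rule smooth_field_on_subset[OF coordinate_field_smooth[OF c(1)]]) simp
  have Y': "smooth_field_on A (U \<inter> fst ?c) Y"
    by (rule smooth_field_on_subset[OF Y]) simp
  have f: "smooth_fun_on A (U \<inter> fst ?c) (f b)" for b
    unfolding f_def by (rule smooth_component[OF c(1) U(1) Y])
  have expand: "(\<Sum>b\<in>Basis. f b q *\<^sub>R E b q) = Y q" if "q \<in> U \<inter> fst ?c" for q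
    unfolding f_def E_def using that by (intro field_in_coordinates c) simp
  have expand_phi: "(\<Sum>b\<in>Basis. f b q *\<^sub>R \<phi> q (E b q)) = \<phi> q (Y q)" if "q \<in> U \<inter> fst ?c" for q
    unfolding expand[OF that, symmetric]
    by (simp add: linear_sum[OF almost_contact_B_metric_space.linear_phi[OF pointwise]] phi_linear_at)
  have "D p v Y = (\<Sum>b\<in>Basis. dir_deriv A p v (f b) *\<^sub>R E b p + f b p *\<^sub>R D p v (E b))"
    by (rule trans[OF connection_local[OF D U' Y' expand, symmetric]], assumption)
       (rule connection_linear_combination[OF D U' finite_Basis f E])
  moreover have "D p v (\<lambda>q. \<phi> q (Y q)) = (\<Sum>b\<in>Basis. dir_deriv A p v (f b) *\<^sub>R \<phi> p (E b p)
      + f b p *\<^sub>R D p v (\<lambda>q. \<phi> q (E b q)))"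
    by (rule trans[OF connection_local[OF D U' smooth_phi[OF U'(1) Y'] expand_phi, symmetric]], assumption)
       (rule connection_linear_combination[OF D U' finite_Basis f smooth_phi[OF U'(1) E]])
  moreover have "f b p = Y p \<bullet> b" for b
    by (simp add: f_def components_transition_deriv transition_deriv_self c)
  ultimately show ?thesis
    unfolding cov_deriv_endo_def E_def[symmetric]
    by (simp add: linear_sum[OF almost_contact_B_metric_space.linear_phi[OF pointwise]] phi_linear_at
        sum_subtractf[symmetric] algebra_simps)
qed

text \<open>The derivative of \<open>\<phi>\<^sup>2 = -Id + \<eta>\<otimes>\<xi>\<close>. It shows at the same time that \<open>(D\<^sub>v\<eta>)Y\<close> depends only on
  the value of \<open>Y\<close> at \<open>p\<close>, because the other terms do.\<close>

lemma cov_deriv_phi_squared: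
  assumes D: "linear_connection A D" and U: "open U" "p \<in> U" and Y: "smooth_field_on A U Y"
  shows "cov_deriv_endo D \<phi> p v (\<lambda>q. \<phi> q (Y q)) + \<phi> p (cov_deriv_endo D \<phi> p v Y) =
    cov_deriv_form A D \<eta> p v Y *\<^sub>R \<xi> p + \<eta> p (Y p) *\<^sub>R D p v \<xi>"
proof -
  note space = pointwise[THEN almost_contact_B_metric_space.phi_phi]
  have xi: "smooth_field_on A U \<xi>"
    by (rule smooth_field_on_subset[OF smooth_xi]) simp
  have phiY: "smooth_field_on A U (\<lambda>q. \<phi> q (\<phi> q (Y q)))"
    by (intro smooth_phi U Y)
  have "D p v (\<lambda>q. \<phi> q (\<phi> q (Y q))) + D p v Y = D p v (\<lambda>q. \<eta> q (Y q) *\<^sub>R \<xi> q)"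
    using connection_add[OF D U phiY Y, of v] by (simp add: space)
  also have "\<dots> = dir_deriv A p v (\<lambda>q. \<eta> q (Y q)) *\<^sub>R \<xi> p + \<eta> p (Y p) *\<^sub>R D p v \<xi>"
    by (rule connection_scaleR[OF D U xi smooth_eta[OF U(1) Y]])
  finally show ?thesis
    unfolding cov_deriv_endo_def cov_deriv_form_def
    by (simp add: phi_linear_at space algebra_simps)
qed

end

theorem proposition3p5:
  fixes A :: "('m::{t2_space,second_countable_topology}, 'e::euclidean_space) chart set"
    and n :: nat
    and \<phi> :: "'m \<Rightarrow> 'e \<Rightarrow> 'e"
    and \<xi> :: "'m \<Rightarrow> 'e"
    and \<eta> :: "'m \<Rightarrow> 'e \<Rightarrow> real"
    and g :: "'m \<Rightarrow> 'e \<Rightarrow> 'e \<Rightarrow> real"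
    and nabla :: "('m, 'e) connection"
  assumes "almost_contact_B_metric_manifold A n \<phi> \<xi> \<eta> g"
    and "levi_civita A g nabla"
  shows "\<forall>p. torsion_tensor A g (phiB_connection A \<phi> \<xi> \<eta> nabla) p \<in>
    subspace_sum {3..15}
      (almost_contact_B_metric_space.torsion_class (\<phi> p) (\<xi> p) (\<eta> p) (g p))"
proof
  fix p
  interpret almost_contact_B_metric_manifold A n \<phi> \<xi> \<eta> g by fact
  interpret V: almost_contact_B_metric_space n "\<phi> p" "\<xi> p" "\<eta> p" "g p" by (rule pointwise)
  have D: "linear_connection A nabla"
    and torsion_free: "\<And>U X Y q. open U \<Longrightarrow> smooth_field_on A U X \<Longrightarrow> smooth_field_on A U Y \<Longrightarrow> q \<in> U \<Longrightarrow>
      torsion A nabla q X Y = 0"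
    using assms(2) unfolding levi_civita_def by blast+
  let ?c = "chart_at A p"
  \<comment> \<open>Coordinate fields extend every tangent vector at \<open>p\<close>; without an extension the description
    that defines the torsion tensor would not determine a value.\<close>
  define E where "E = coordinate_field ?c"
  have nbhd: "open (fst ?c)" "p \<in> fst ?c" by (rule open_chart chart_at)+
  have E: "smooth_field_on A (fst ?c) (E y)" "E y p = y" for y
    unfolding E_def by (rule coordinate_field_smooth coordinate_field_at chart_at)+
  define N where "N v y = (\<Sum>b\<in>Basis. (y \<bullet> b) *\<^sub>R cov_deriv_endo nabla \<phi> p v (E b))" for v y
  have N: "cov_deriv_endo nabla \<phi> p v Y = N v (Y p)"
    if "open U" "p \<in> U" "smooth_field_on A U Y" for U v Y
    unfolding N_def E_def by (rule cov_deriv_phi_tensorial[OF D that])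
  define K where "K v = nabla p v \<xi>" for v
  have K: "linear K"
    unfolding K_def by (rule connection_linear[OF D open_UNIV UNIV_I smooth_xi])
  define a where "a v y = cov_deriv_form A nabla \<eta> p v (E y)" for v y
  have N_phi: "N v (\<phi> p (Y p)) + \<phi> p (N v (Y p)) =
      cov_deriv_form A nabla \<eta> p v Y *\<^sub>R \<xi> p + \<eta> p (Y p) *\<^sub>R K v"
    if "open U" "p \<in> U" "smooth_field_on A U Y" for U v Y
    using cov_deriv_phi_squared[OF D that] N[OF that] N[OF that(1,2) smooth_phi[OF that(1,3)]]
    by (simp add: K_def)
  note N_phi_E = N_phi[OF nbhd E(1), unfolded E(2), folded a_def]
  \<comment> \<open>Both sides are determined by \<open>N\<close> and \<open>K\<close>, hence by \<open>Y p\<close>.\<close>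
  have a: "cov_deriv_form A nabla \<eta> p v Y *\<^sub>R \<xi> p = a v (Y p) *\<^sub>R \<xi> p"
    if "open U" "p \<in> U" "smooth_field_on A U Y" for U v Y
    using N_phi[OF that] N_phi_E[of v "Y p"] by simp
  define Q where "Q x y = (1/2) *\<^sub>R (N x (\<phi> p y) + a x y *\<^sub>R \<xi> p) - \<eta> p y *\<^sub>R K x" for x y
  have phiB: "phiB_connection A \<phi> \<xi> \<eta> nabla p x Y = nabla p x Y + Q x (Y p)"
    if "open U" "p \<in> U" "smooth_field_on A U Y" for U x Y
    using a[OF that] N[OF that(1,2) smooth_phi[OF that(1,3)]]
    by (simp add: phiB_connection_def Q_def K_def)
  have phiB_torsion: "torsion A (phiB_connection A \<phi> \<xi> \<eta> nabla) p X Y = Q (X p) (Y p) - Q (Y p) (X p)"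
    if "open U" "p \<in> U" "smooth_field_on A U X" "smooth_field_on A U Y" for U X Y
    using torsion_free[OF that(1,3,4,2)] phiB[OF that(1,2,3)] phiB[OF that(1,2,4)]
    by (simp add: torsion_def)
  have "torsion_tensor A g (phiB_connection A \<phi> \<xi> \<eta> nabla) p = (\<lambda>x y z. g p (Q x y - Q y x) z)"
  proof (intro ext)
    fix x y z
    have "(THE w. \<forall>U X Y. open U \<longrightarrow> p \<in> U \<longrightarrow> smooth_field_on A U X \<longrightarrow> smooth_field_on A U Y \<longrightarrow>
        X p = x \<longrightarrow> Y p = y \<longrightarrow> w = torsion A (phiB_connection A \<phi> \<xi> \<eta> nabla) p X Y) = Q x y - Q y x"
    proof (rule the_equality)
      show "\<forall>U X Y. open U \<longrightarrow> p \<in> U \<longrightarrow> smooth_field_on A U X \<longrightarrow> smooth_field_on A U Y \<longrightarrow>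
        X p = x \<longrightarrow> Y p = y \<longrightarrow> Q x y - Q y x = torsion A (phiB_connection A \<phi> \<xi> \<eta> nabla) p X Y"
        using phiB_torsion by simp
    next
      fix w
      assume "\<forall>U X Y. open U \<longrightarrow> p \<in> U \<longrightarrow> smooth_field_on A U X \<longrightarrow> smooth_field_on A U Y \<longrightarrow>
        X p = x \<longrightarrow> Y p = y \<longrightarrow> w = torsion A (phiB_connection A \<phi> \<xi> \<eta> nabla) p X Y"
      then have "w = torsion A (phiB_connection A \<phi> \<xi> \<eta> nabla) p (E x) (E y)"
        using nbhd E by blast
      then show "w = Q x y - Q y x"
        using phiB_torsion[OF nbhd E(1) E(1)] by (simp add: E(2))
    qed
    then show "torsion_tensor A g (phiB_connection A \<phi> \<xi> \<eta> nabla) p x y z = g p (Q x y - Q y x) z"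
      by (simp add: torsion_tensor_def)
  qed
  moreover have "bilinear N"
  proof -
    have "linear (\<lambda>v. cov_deriv_endo nabla \<phi> p v (E b))" for b
      unfolding cov_deriv_endo_def
      using connection_linear[OF D nbhd E(1)] connection_linear[OF D nbhd smooth_phi[OF nbhd(1) E(1)]]
      by (intro linear_compose_sub linear_compose[OF _ V.linear_phi, unfolded o_def])
    then have "linear (\<lambda>v. N v y)" for y
      unfolding N_def by (intro linear_compose_sum ballI linear_compose_scale_right)
    moreover have "linear (N v)" for v
      unfolding N_def by (intro linearI) (simp_all add: inner_simps scaleR_add_left sum.distrib scaleR_sum_right)
    ultimately show ?thesis by (simp add: bilinear_def)
  qed
  ultimately show "torsion_tensor A g (phiB_connection A \<phi> \<xi> \<eta> nabla) p \<in>
    subspace_sum {3..15} (almost_contact_B_metric_space.torsion_class (\<phi> p) (\<xi> p) (\<eta> p) (g p))"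
    using V.phiB_torsion_class[OF _ K N_phi_E Q_def] by simp
qed

end
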